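(* Let $K=\{4^m: m\ge 1\}\cup\{2\cdot p^m+2: p\in\{7,31,127\},\ m\ge 1\}$. There exists a $\mathrm{TOC}_3(n,3,3)$ for every $n\in K$.
   Context: $\mathcal{H}_q(n,w)$ is the set of all words of length $n$ over $\mathbb{Z}_q$ with exactly $w$ nonzero entries, with the Hamming distance. An $(n,d,w)_q$-code is a nonempty subset of $\mathcal{H}_q(n,w)$ in which any two distinct words have Hamming distance at least $d$; $A_q(n,d,w)$ is the maximum size of such a code and a code of this size is optimal. A $\mathrm{TOC}_q(n,d,w)$ is a partition of $\mathcal{H}_q(n,w)$ into mutually disjoint optimal $(n,d,w)_q$-codes. *)

theory Defs
  imports Main
begin

text \<open>Words of length n over Z_q are lists of length n with entries in {0..<q}.\<close>

definition wt :: "nat list \<Rightarrow> nat" where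
  "wt x = card {i. i < length x \<and> x ! i \<noteq> 0}"

definition hdist :: "nat list \<Rightarrow> nat list \<Rightarrow> nat" where
  "hdist x y = card {i. i < length x \<and> x ! i \<noteq> y ! i}"

definition Hq :: "nat \<Rightarrow> nat \<Rightarrow> nat \<Rightarrow> nat list set" where
  "Hq q n w = {x. length x = n \<and> set x \<subseteq> {..<q} \<and> wt x = w}"

definition is_code :: "nat \<Rightarrow> nat \<Rightarrow> nat \<Rightarrow> nat \<Rightarrow> nat list set \<Rightarrow> bool" where
  "is_code q n d w C \<longleftrightarrow> C \<noteq> {} \<and> C \<subseteq> Hq q n w \<and>
     (\<forall>x\<in>C. \<forall>y\<in>C. x \<noteq> y \<longrightarrow> d \<le> hdist x y)"

definition Aq :: "nat \<Rightarrow> nat \<Rightarrow> nat \<Rightarrow> nat \<Rightarrow> nat" where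
  "Aq q n d w = Max {card C | C. is_code q n d w C}"

definition optimal_code :: "nat \<Rightarrow> nat \<Rightarrow> nat \<Rightarrow> nat \<Rightarrow> nat list set \<Rightarrow> bool" where
  "optimal_code q n d w C \<longleftrightarrow> is_code q n d w C \<and> card C = Aq q n d w"

definition is_TOC :: "nat \<Rightarrow> nat \<Rightarrow> nat \<Rightarrow> nat \<Rightarrow> nat list set set \<Rightarrow> bool" where
  "is_TOC q n d w P \<longleftrightarrow> \<Union>P = Hq q n w \<and>
     (\<forall>C\<in>P. optimal_code q n d w C) \<and>
     (\<forall>C\<in>P. \<forall>D\<in>P. C \<noteq> D \<longrightarrow> C \<inter> D = {})"

definition Kset :: "nat set" where
  "Kset = {4 ^ m | m. m \<ge> 1} \<union> {2 * p ^ m + 2 | p m. p \<in> {7, 31, 127} \<and> m \<ge> 1}"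

end

theory Submission
  imports Defs "HOL-Algebra.Algebraic_Closure_Type" "HOL-Library.Z2" "HOL-Library.Product_Plus"
    "HOL-Library.FuncSet" "HOL-Library.Numeral_Type" "HOL-Computational_Algebra.Primes"
begin

text \<open>A pair of positions with prescribed nonzero entries lies in at most one word of an \<open>(n,3,3)\<close>-code, so a
  code has at most \<open>2n(n-1)/3\<close> words. As there are \<open>2(n-2)\<close> times as many words of weight 3, it suffices to
  colour these with \<open>2(n-2)\<close> colours such that words at distance less than 3 get different colours.

  If a Steiner quadruple system is partitioned into \<open>(n-2)/2\<close> systems \<open>S(2,4,n)\<close>, colour a word by the part
  containing the block through its support and by its place in a tiling of the words on that block by four
  optimal codes. For \<open>n = 4^m\<close> such a partition is due to Baker.

  For \<open>n = 2p^m + 2\<close> with \<open>p = 2^k - 1\<close> prime, take two points over each point of \<open>AG(m,p)\<close> and two points at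
  infinity. The points over a line together with infinity carry Baker's system of order \<open>2^(k+1)\<close>, with
  the points of the line as colours of blocks. A triple over three non-collinear points is coloured by their
  centroid, refined by a Latin cube of order 4.\<close>

section \<open>Tilings from proper colourings\<close>

text \<open>The counting leaves no slack, so every class meets the bound and the value of
  \<open>Aq\<close> is a by-product. Over AG(m,p) the budget is 4p^m colours, one point of the space
  times four, so collinear and non-collinear triples must share the points as colours. Three
  coincidences have to be harmless. A triple on a line L only receives points of L, whereas the
  centroid of a non-collinear triple lies off the line through any two of its points. Two lines
  through c both use c, but all that their systems share is the four points over c and infinity, and
  these form a block of colour c in both. Two non-collinear triples with a common pair of points and
  the same centroid lie over the same three points, where the Latin cube takes over. The arithmetic
  follows: the p points of a line are matched with the nonzero elements of GF(2^k), hence p = 2^k -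
  1; k is odd so that cubing permutes GF(2^k); and 3 must be invertible modulo p for centroids to
  exist.\<close>

definition supp :: "('a \<Rightarrow> nat) \<Rightarrow> 'a set" where
  "supp w = {a. w a \<noteq> 0}"

definition signed_triples :: "'a set \<Rightarrow> ('a \<Rightarrow> nat) set" where
  "signed_triples pts = {w. supp w \<subseteq> pts \<and> card (supp w) = 3 \<and> (\<forall>a. w a < 3)}"

text \<open>For distinct words of weight 3 this is distance less than 3, put in terms of agreements
  so that it makes sense for words indexed by the points of a geometry.\<close>

definition clash :: "('a \<Rightarrow> nat) \<Rightarrow> ('a \<Rightarrow> nat) \<Rightarrow> bool" where
  "clash w v \<longleftrightarrow> w \<noteq> v \<and>
     (supp w = supp v \<and> (\<exists>a\<in>supp w. w a = v a) \<or>
      (\<exists>a\<in>supp w. \<exists>b\<in>supp w. a \<noteq> b \<and> w a = v a \<and> w b = v b))"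

definition proper_on :: "'a set \<Rightarrow> (('a \<Rightarrow> nat) \<Rightarrow> 'c) \<Rightarrow> bool" where
  "proper_on pts f \<longleftrightarrow>
     (\<forall>w\<in>signed_triples pts. \<forall>v\<in>signed_triples pts. clash w v \<longrightarrow> f w \<noteq> f v)"

section \<open>Counting words and bounding codes\<close>

lemma finite_Hq: "finite (Hq q n w)"
  by (rule finite_subset[OF _ finite_lists_length_eq[of "{..<q}" n]]) (auto simp: Hq_def)

lemma six_choose_three: "6 * (n choose 3) = n * (n - 1) * (n - 2)"
proof -
  have 1: "3 * (n choose 3) = n * ((n - 1) choose 2)"
    using binomial_absorption[of 2 n] by (simp add: numeral_3_eq_3)
  have 2: "2 * ((n - 1) choose 2) = (n - 1) * (n - 2)"
    using binomial_absorption[of 1 "n - 1"] by (simp add: numeral_2_eq_2)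
  have "6 * (n choose 3) = 2 * (3 * (n choose 3))" by simp
  also have "\<dots> = n * (2 * ((n - 1) choose 2))" unfolding 1 by simp
  also have "\<dots> = n * (n - 1) * (n - 2)" unfolding 2 by simp
  finally show ?thesis .
qed

lemma card_Hq3_ge: "8 * (n choose 3) \<le> card (Hq 3 n 3)"
proof -
  let ?S = "SIGMA S:{S. S \<subseteq> {..<n} \<and> card S = 3}. S \<rightarrow>\<^sub>E {1..<3::nat}"
  let ?f = "\<lambda>(S, g). map (\<lambda>i. if i \<in> S then g i else 0) [0..<n]"
  have nz: "{i. i < length (?f (S, g)) \<and> ?f (S, g) ! i \<noteq> 0} = S"
    if "S \<subseteq> {..<n}" "g \<in> S \<rightarrow>\<^sub>E {1..<3::nat}" for S g
  proof -
    have "g i \<noteq> 0" if "i \<in> S" for i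
      using PiE_mem[OF \<open>g \<in> _\<close> that] by simp
    then show ?thesis using \<open>S \<subseteq> {..<n}\<close> by (auto split: if_splits)
  qed
  have "card ?S = (\<Sum>S | S \<subseteq> {..<n} \<and> card S = 3. card (S \<rightarrow>\<^sub>E {1..<3::nat}))"
    by (rule card_SigmaI) (auto intro!: finite_PiE intro: finite_subset)
  also have "\<dots> = (\<Sum>S | S \<subseteq> {..<n} \<and> card S = 3. 8)"
    by (rule sum.cong) (auto simp: card_PiE finite_subset)
  also have "\<dots> = 8 * (n choose 3)"
    by (simp add: n_subsets)
  finally have card: "card ?S = 8 * (n choose 3)" .
  have "inj_on ?f ?S"
  proof (rule inj_onI, clarify)
    fix S g T h
    assume S: "S \<subseteq> {..<n}" "g \<in> S \<rightarrow>\<^sub>E {1..<3::nat}" and T: "T \<subseteq> {..<n}" "h \<in> T \<rightarrow>\<^sub>E {1..<3::nat}"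
      and eq: "map (\<lambda>i. if i \<in> S then g i else 0) [0..<n] = map (\<lambda>i. if i \<in> T then h i else 0) [0..<n]"
    have ST: "S = T" using nz[OF S] nz[OF T] eq by simp
    have "g i = h i" if "i \<in> S" for i
    proof -
      have "i < n" "i \<in> T" using that S(1) ST by auto
      then show ?thesis using that arg_cong[OF eq, of "\<lambda>l. l ! i"] by simp
    qed
    then show "S = T \<and> g = h" using ST S T by (auto intro: PiE_ext)
  qed
  moreover have "?f ` ?S \<subseteq> Hq 3 n 3"
  proof clarify
    fix S g assume S: "S \<subseteq> {..<n}" "g \<in> S \<rightarrow>\<^sub>E {1..<3::nat}" "card S = 3"
    then have "\<And>i. i \<in> S \<Longrightarrow> g i < 3" by (auto simp: PiE_def Pi_def)
    with nz[OF S(1,2)] S show "map (\<lambda>i. if i \<in> S then g i else 0) [0..<n] \<in> Hq 3 n 3"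
      by (auto simp: Hq_def wt_def)
  qed
  ultimately have "card ?S \<le> card (Hq 3 n 3)"
    by (rule card_inj_on_le[OF _ _ finite_Hq])
  then show ?thesis unfolding card .
qed

text \<open>Let D be the set of the at most two disagreements. Outside D the supports coincide, and
  some support position remains there. If only one remains, D consists of the other two positions of
  either support, so the supports are equal.\<close>

lemma agree_of_hdist_less_3:
  assumes x: "x \<in> Hq q n 3" and y: "y \<in> Hq q n 3" and d: "hdist x y < 3"
  defines "pts \<equiv> {i. i < n \<and> x ! i \<noteq> 0}" and "Y \<equiv> {i. i < n \<and> y ! i \<noteq> 0}"
  shows "pts = Y \<and> (\<exists>i\<in>pts. x ! i = y ! i) \<or>
         (\<exists>i\<in>pts. \<exists>j\<in>pts. i \<noteq> j \<and> x ! i = y ! i \<and> x ! j = y ! j)"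
proof -
  define D where "D = {i. i < n \<and> x ! i \<noteq> y ! i}"
  have len: "length x = n" "length y = n" using x y by (auto simp: Hq_def)
  have card_supports: "card pts = 3" "card Y = 3" using x y by (auto simp: Hq_def wt_def pts_def Y_def)
  have fin: "finite pts" "finite Y" "finite D" by (auto simp: pts_def Y_def D_def)
  have cD: "card D \<le> 2" using d len by (simp add: hdist_def D_def)
  have same_diff: "pts - D = Y - D" by (auto simp: pts_def Y_def D_def)
  have agree: "x ! i = y ! i" if "i \<in> pts - D" for i using that by (auto simp: pts_def D_def)
  have "card (pts - D) \<ge> 1" using diff_card_le_card_Diff[OF fin(3), of pts] card_supports cD by linarith
  then have ne: "pts - D \<noteq> {}" by (metis card.empty not_one_le_zero)
  show ?thesis
  proof (cases "card (pts - D) \<ge> 2")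
    case True
    then obtain i j where "i \<in> pts - D" "j \<in> pts - D" "i \<noteq> j"
      using card_le_Suc0_iff_eq[of "pts - D"] fin by fastforce
    then show ?thesis using agree by blast
  next
    case False
    have sub: "D \<subseteq> Z" if "card (Z - D) \<le> 1" "finite Z" "card Z = 3" for Z
    proof -
      have "card (Z - D) + card (Z \<inter> D) = 3"
        using card_Diff_subset_Int[of Z D] card_mono[of Z "Z \<inter> D"] that fin by (simp add: le_add_diff_inverse2)
      then have "card D \<le> card (Z \<inter> D)" using that cD by linarith
      then have "Z \<inter> D = D" using card_seteq[of D "Z \<inter> D"] fin by blast
      then show ?thesis by blast
    qed
    have "D \<subseteq> pts" "D \<subseteq> Y" using sub[of pts] sub[of Y] False same_diff fin card_supports by auto
    then have "pts = Y" using same_diff by blast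
    then show ?thesis using ne agree by blast
  qed
qed

text \<open>Each codeword has 6 ordered pairs of support positions, and a pair together with its two
  entries determines the codeword. There are n(n-1) pairs and 4 choices of entries.\<close>

lemma card_code_le:
  assumes "is_code 3 n 3 3 C"
  shows "3 * card C \<le> 2 * n * (n - 1)"
proof -
  let ?s = "\<lambda>x::nat list. {i. i < n \<and> x ! i \<noteq> 0}"
  let ?P = "\<lambda>A::nat set. {(i, j). i \<in> A \<and> j \<in> A \<and> i \<noteq> j}"
  have code: "C \<subseteq> Hq 3 n 3" "\<And>x y. x \<in> C \<Longrightarrow> y \<in> C \<Longrightarrow> x \<noteq> y \<Longrightarrow> 3 \<le> hdist x y"
    using assms by (auto simp: is_code_def)
  have finC: "finite C" using code(1) finite_Hq finite_subset by blast
  have cardP: "card (?P A) = card A * (card A - 1)" if "finite A" for A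
  proof -
    have "?P A = A \<times> A - (\<lambda>i. (i, i)) ` A" by auto
    moreover have "card ((\<lambda>i. (i, i)) ` A) = card A" by (simp add: card_image inj_on_def)
    ultimately show ?thesis
      using that by (simp add: card_Diff_subset image_subset_iff card_cartesian_product diff_mult_distrib2)
  qed
  let ?D = "SIGMA x:C. ?P (?s x)"
  let ?f = "\<lambda>(x::nat list, i, j). ((i, j), (x ! i, x ! j))"
  have "card (?P (?s x)) = 6" if "x \<in> C" for x
  proof -
    have "card (?s x) = 3" using that code by (auto simp: Hq_def wt_def)
    then show ?thesis using cardP[of "?s x"] by simp
  qed
  moreover have finP: "finite (?P A)" if "finite A" for A
    by (rule finite_subset[of _ "A \<times> A"]) (use that in auto)
  moreover have "finite (?P (?s x))" for x by (rule finP) simp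
  ultimately have "card ?D = 6 * card C"
    using finC by (subst card_SigmaI) (simp_all del: mem_Collect_eq)
  moreover have "inj_on ?f ?D"
  proof (rule inj_onI)
    fix t u assume tu: "t \<in> ?D" "u \<in> ?D" "?f t = ?f u"
    then obtain x i j y where t: "t = (x, i, j)" "u = (y, i, j)" and *: "x \<in> C" "y \<in> C" "i < n" "j < n" "i \<noteq> j" "x ! i \<noteq> 0" "x ! j \<noteq> 0"
      "x ! i = y ! i" "x ! j = y ! j"
      by auto
    have "x = y"
    proof (rule ccontr)
      assume "x \<noteq> y"
      let ?E = "{k. k < n \<and> x ! k \<noteq> y ! k}"
      have c: "card (?s x) = 3" "card (?s y) = 3" "length x = n"
        using * code by (auto simp: Hq_def wt_def)
      \<comment> \<open>Disagreements occur only at the one remaining support position of each word,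
        so there are at most two.\<close>
      have "?E \<subseteq> (?s x - {i, j}) \<union> (?s y - {i, j})" using * by auto
      then have "card ?E \<le> card ((?s x - {i, j}) \<union> (?s y - {i, j}))" by (intro card_mono) auto
      also have "\<dots> \<le> card (?s x - {i, j}) + card (?s y - {i, j})" by (rule card_Un_le)
      also have "\<dots> = 2" using * c by (simp add: card_Diff_subset)
      finally show False using code(2)[of x y] * c \<open>x \<noteq> y\<close> by (simp add: hdist_def)
    qed
    then show "t = u" using t by simp
  qed
  moreover have "?f ` ?D \<subseteq> ?P {..<n} \<times> ({1,2} \<times> {1,2})"
  proof (rule image_subsetI)
    fix t assume "t \<in> ?D"
    then obtain x i j where t: "t = (x, i, j)"
      and *: "x \<in> C" "i < n" "j < n" "i \<noteq> j" "0 < x ! i" "0 < x ! j" by auto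
    then have "set x \<subseteq> {..<3}" "length x = n" using code by (auto simp: Hq_def)
    then have "x ! i < 3" "x ! j < 3" using * nth_mem[of i x] nth_mem[of j x] by (metis lessThan_iff subsetD)+
    then show "?f t \<in> ?P {..<n} \<times> ({1,2} \<times> {1,2})" using * t by auto
  qed
  moreover have "finite (?P {..<n} \<times> ({1,2::nat} \<times> {1,2::nat}))" using finP by blast
  ultimately have "card ?D = 6 * card C" "card ?D \<le> card (?P {..<n} \<times> ({1,2::nat} \<times> {1,2::nat}))"
    by (blast, intro card_inj_on_le[of ?f])
  then have "6 * card C \<le> card (?P {..<n} \<times> ({1,2::nat} \<times> {1,2::nat}))" by (simp only:)
  also have "\<dots> = 4 * (n * (n - 1))"
    using cardP[of "{..<n}"] by (simp add: card_cartesian_product)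
  finally show ?thesis by simp
qed

text \<open>As n is 1 modulo 3, the bound is an integer M. At most 2(n-2) classes, each of size at
  most M, cover at least 2(n-2)M words, so each has exactly M. The classes thereby attain the bound,
  which shows that M is the maximum.\<close>

lemma TOC_of_proper_list_colouring:
  assumes n: "n \<ge> 4" "n mod 3 = 1"
    and C: "finite C" "card C \<le> 2 * (n - 2)" "f ` Hq 3 n 3 \<subseteq> C"
    and proper: "\<And>x y. x \<in> Hq 3 n 3 \<Longrightarrow> y \<in> Hq 3 n 3 \<Longrightarrow> x \<noteq> y \<Longrightarrow> hdist x y < 3 \<Longrightarrow> f x \<noteq> f y"
  shows "\<exists>P. is_TOC 3 n 3 3 P"
proof -
  let ?K = "\<lambda>c. {x \<in> Hq 3 n 3. f x = c}"
  obtain k where k: "n = 3 * k + 1" using n(2) by (metis mod_mult_div_eq add.commute)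
  define M where "M = 2 * n * k"
  have M: "3 * M = 2 * n * (n - 1)" by (simp add: M_def k)
  have bound: "card D \<le> M" if "is_code 3 n 3 3 D" for D
    using card_code_le[OF that] M by linarith
  have code: "is_code 3 n 3 3 (?K c)" if "?K c \<noteq> {}" for c
    using that proper unfolding is_code_def by force
  have le: "card (?K c) \<le> M" for c
  proof (cases "?K c = {}")
    case False
    then show ?thesis by (rule bound[OF code])
  next
    case True
    then show ?thesis by (simp only: card.empty)
  qed
  have "Hq 3 n 3 = (\<Union>c\<in>C. ?K c)" using C(3) by auto
  then have "card (Hq 3 n 3) = card (\<Union>c\<in>C. ?K c)" by (rule arg_cong)
  also have "\<dots> = (\<Sum>c\<in>C. card (?K c))"
    using C(1) finite_Hq[of 3 n 3] by (intro card_UN_disjoint) auto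
  finally have sum: "card (Hq 3 n 3) = (\<Sum>c\<in>C. card (?K c))" .
  have tot: "2 * (n - 2) * M \<le> card (Hq 3 n 3)"
  proof -
    have "6 * (2 * (n - 2) * M) = 4 * (n - 2) * (3 * M)" by simp
    also have "\<dots> = 8 * (n * (n - 1) * (n - 2))" unfolding M by simp
    also have "\<dots> = 6 * (8 * (n choose 3))" using six_choose_three[of n] by simp
    finally show ?thesis using card_Hq3_ge[of n] by linarith
  qed
  have "card C * M \<le> 2 * (n - 2) * M" using C(2) by simp
  then have geC: "card C * M \<le> (\<Sum>c\<in>C. card (?K c))" using tot sum by linarith
  have eq: "card (?K c) = M" if "c \<in> C" for c
  proof (rule ccontr)
    assume "card (?K c) \<noteq> M"
    then have "card (?K c) < M" using le[of c] by linarith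
    then have "(\<Sum>c\<in>C. card (?K c)) < (\<Sum>c\<in>C. M)"
      using that C(1) le by (intro sum_strict_mono_ex1) auto
    then show False using geC by simp
  qed
  have "M > 0" using n by (simp add: M_def k)
  have isc: "is_code 3 n 3 3 (?K c)" if "c \<in> C" for c
    using code[of c] eq[OF that] \<open>M > 0\<close> by (metis card.empty less_not_refl)
  have "2 * (n - 2) * M > 0" using n \<open>M > 0\<close> by simp
  then have "C \<noteq> {}" using tot sum by auto
  then obtain c0 where "c0 \<in> C" by blast
  have Aq: "Aq 3 n 3 3 = M"
    unfolding Aq_def
  proof (rule Max_eqI)
    have "{card D |D. is_code 3 n 3 3 D} \<subseteq> {..M}" using bound by auto
    then show "finite {card D |D. is_code 3 n 3 3 D}" using finite_subset by blast
    show "M \<in> {card D |D. is_code 3 n 3 3 D}" using isc[OF \<open>c0 \<in> C\<close>] eq[OF \<open>c0 \<in> C\<close>] by blast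
  qed (use bound in auto)
  have "is_TOC 3 n 3 3 (?K ` C)"
    unfolding is_TOC_def optimal_code_def Aq using isc eq C(3) by auto
  then show ?thesis by blast
qed

theorem TOC_of_proper_colouring:
  assumes pts: "finite pts" "card pts = n" and n: "n \<ge> 4" "n mod 3 = 1"
    and C: "finite C" "card C \<le> 2 * (n - 2)" "f ` signed_triples pts \<subseteq> C"
    and proper: "proper_on pts f"
  shows "\<exists>P. is_TOC 3 n 3 3 P"
proof -
  obtain h where h: "bij_betw h pts {..<n}"
    using ex_bij_betw_finite_nat[OF pts(1)] pts(2) by (auto simp: atLeast0LessThan)
  define g where "g x a = (if a \<in> pts then x ! h a else 0)" for x :: "nat list" and a
  have supp: "supp (g x) \<subseteq> pts" "h ` supp (g x) = {i. i < n \<and> x ! i \<noteq> 0}" for x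
    using h by (auto simp: supp_def g_def bij_betw_def split: if_splits)
  have inj: "inj_on h (supp (g x))" for x
    using h supp(1) by (meson bij_betw_imp_inj_on inj_on_subset)
  have st: "g x \<in> signed_triples pts" if "x \<in> Hq 3 n 3" for x
  proof -
    have "card (supp (g x)) = 3"
      using card_image[OF inj[of x]] supp(2)[of x] that by (auto simp: Hq_def wt_def)
    moreover have "g x a < 3" for a
    proof -
      have "h a < length x" if "a \<in> pts" using that h \<open>x \<in> _\<close> by (auto simp: bij_betw_def Hq_def)
      moreover have "x ! i < 3" if "i < length x" for i
        using nth_mem[OF that] \<open>x \<in> _\<close> by (auto simp: Hq_def)
      ultimately show ?thesis by (auto simp: g_def)
    qed
    ultimately show ?thesis using supp(1) by (simp add: signed_triples_def)
  qed
  have "clash (g x) (g y)"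
    if xy: "x \<in> Hq 3 n 3" "y \<in> Hq 3 n 3" "x \<noteq> y" "hdist x y < 3" for x y
  proof -
    have pre: "\<exists>a\<in>supp (g x). h a = i \<and> (x ! i = y ! i \<longrightarrow> g x a = g y a)"
      if "i < n" "x ! i \<noteq> 0" for i
    proof -
      have "i \<in> h ` supp (g x)" using that supp(2) by auto
      then obtain a where "a \<in> supp (g x)" "h a = i" by blast
      then show ?thesis by (auto simp: g_def)
    qed
    have "g x \<noteq> g y"
    proof
      assume eq: "g x = g y"
      have "x ! i = y ! i" if "i < n" for i
      proof -
        have "i \<in> h ` pts" using that h by (simp add: bij_betw_def)
        then obtain a where "a \<in> pts" "h a = i" by blast
        then show ?thesis using fun_cong[OF eq, of a] by (auto simp: g_def)
      qed
      then show False using xy by (auto simp: Hq_def intro: nth_equalityI)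
    qed
    moreover have "supp (g x) = supp (g y)"
      if "{i. i < n \<and> x ! i \<noteq> 0} = {i. i < n \<and> y ! i \<noteq> 0}"
      using that supp inj_on_image_eq_iff[of h pts "supp (g x)" "supp (g y)"] h by (auto simp: bij_betw_def)
    ultimately have ne: "g x \<noteq> g y"
      and eq: "{i. i < n \<and> x ! i \<noteq> 0} = {i. i < n \<and> y ! i \<noteq> 0} \<Longrightarrow> supp (g x) = supp (g y)" by blast+
    from agree_of_hdist_less_3[OF xy(1,2,4)] show ?thesis
    proof (elim disjE conjE bexE)
      fix i assume "i \<in> {i. i < n \<and> x ! i \<noteq> 0}" "x ! i = y ! i"
        and "{i. i < n \<and> x ! i \<noteq> 0} = {i. i < n \<and> y ! i \<noteq> 0}"
      then show ?thesis using pre[of i] eq ne unfolding clash_def by blast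
    next
      fix i j assume "i \<in> {i. i < n \<and> x ! i \<noteq> 0}" "j \<in> {i. i < n \<and> x ! i \<noteq> 0}"
        and "i \<noteq> j" "x ! i = y ! i" "x ! j = y ! j"
      then obtain a b where "a \<in> supp (g x)" "b \<in> supp (g x)" "a \<noteq> b" "g x a = g y a" "g x b = g y b"
        using pre[of i] pre[of j] by auto
      then show ?thesis using ne unfolding clash_def by blast
    qed
  qed
  then have "f (g x) \<noteq> f (g y)"
    if "x \<in> Hq 3 n 3" "y \<in> Hq 3 n 3" "x \<noteq> y" "hdist x y < 3" for x y
    using that st proper by (auto simp: proper_on_def)
  moreover have "(f \<circ> g) ` Hq 3 n 3 \<subseteq> C" using C(3) st by auto
  ultimately show ?thesis
    using TOC_of_proper_list_colouring[OF n C(1,2), of "f \<circ> g"] by auto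
qed

section \<open>Baker's resolution of the affine quadruple system\<close>

text \<open>For \<^term>\<open>blk T\<close> the block of a Steiner quadruple system through a triple \<open>T\<close>, this says that the
  colour classes of the blocks are 2-designs; the colour of a block is read off any triple in it.\<close>

definition resolved_blocks :: "'a set \<Rightarrow> ('a set \<Rightarrow> 'a set) \<Rightarrow> ('a set \<Rightarrow> 'c) \<Rightarrow> bool" where
  "resolved_blocks pts blk cls \<longleftrightarrow>
     (\<forall>T. T \<subseteq> pts \<and> card T = 3 \<longrightarrow> T \<subseteq> blk T \<and> blk T \<subseteq> pts \<and> card (blk T) = 4) \<and>
     (\<forall>T T' a b. T \<subseteq> pts \<and> card T = 3 \<and> T' \<subseteq> pts \<and> card T' = 3 \<and> a \<noteq> b \<and>
        {a, b} \<subseteq> T \<inter> T' \<and> cls T = cls T' \<longrightarrow> blk T = blk T')"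

lemma resolved_blocks_block:
  assumes "resolved_blocks pts blk cls" "T \<subseteq> pts" "card T = 3"
  shows "T \<subseteq> blk T" "blk T \<subseteq> pts" "card (blk T) = 4"
  using assms unfolding resolved_blocks_def by simp_all

lemma resolved_blocks_eq:
  assumes "resolved_blocks pts blk cls" "T \<subseteq> pts" "card T = 3" "T' \<subseteq> pts" "card T' = 3"
    and "a \<noteq> b" "{a, b} \<subseteq> T \<inter> T'" "cls T = cls T'"
  shows "blk T = blk T'"
  using assms(1)[unfolded resolved_blocks_def, THEN conjunct2, rule_format, of T T' a b] assms(2-8)
  by simp

text \<open>A copy of GF(2^k) with k odd; the last axiom says that it has no primitive cube root of
  unity. It is a subset of a field type because k varies while the type, later an algebraic closure,
  stays fixed.\<close>

locale odd_gf2 =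
  fixes F :: "'f::field set"
  assumes finite_F: "finite F"
    and one_F: "1 \<in> F"
    and add_F: "x \<in> F \<Longrightarrow> y \<in> F \<Longrightarrow> x + y \<in> F"
    and mult_F: "x \<in> F \<Longrightarrow> y \<in> F \<Longrightarrow> x * y \<in> F"
    and inverse_F: "x \<in> F \<Longrightarrow> inverse x \<in> F"
    and char2: "(1::'f) + 1 = 0"
    and no_omega: "x \<in> F \<Longrightarrow> x\<^sup>2 + x + 1 \<noteq> 0"
begin

lemma two_eq_0 [simp]: "(2::'f) = 0"
  using char2 by simp

lemma double [simp]: "(x::'f) + x = 0"
  by (metis mult_2 mult_zero_left two_eq_0)

lemma double' [simp]: "(x::'f) + (x + y) = y"
  by (simp flip: add.assoc)

lemma zero_F: "0 \<in> F"
  using add_F[OF one_F one_F] by simp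

text \<open>Division by y^2 would make x/y a root of t^2 + t + 1. This form is the cofactor of x + y
  in x^3 + y^3, which is how it governs injectivity of cubing.\<close>

lemma norm_form_nonzero:
  assumes "x \<in> F" "y \<in> F" "y \<noteq> 0"
  shows "x\<^sup>2 + x * y + y\<^sup>2 \<noteq> 0"
proof
  assume "x\<^sup>2 + x * y + y\<^sup>2 = 0"
  then have "(x * inverse y)\<^sup>2 + x * inverse y + 1 = 0"
    using assms(3) by (simp add: field_simps power2_eq_square)
  then show False using no_omega mult_F inverse_F assms by blast
qed

lemma cube_add: "(x::'f) ^ 3 + y ^ 3 = (x + y) * (x\<^sup>2 + x * y + y\<^sup>2)"
proof -
  have "(x + y) * (x\<^sup>2 + x * y + y\<^sup>2) = x ^ 3 + y ^ 3 + (x\<^sup>2 * y + x\<^sup>2 * y) + (x * y\<^sup>2 + x * y\<^sup>2)"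
    by (simp add: algebra_simps power2_eq_square power3_eq_cube del: double double')
  then show ?thesis by simp
qed

lemma eq_of_add_eq_0: "(x::'f) + y = 0 \<Longrightarrow> x = y"
  by (metis double add_right_cancel)

lemma cube_inj:
  assumes "x \<in> F" "y \<in> F" "x ^ 3 = y ^ 3"
  shows "x = y"
proof (cases "y = 0")
  case True
  then show ?thesis using assms by simp
next
  case False
  have "(x + y) * (x\<^sup>2 + x * y + y\<^sup>2) = 0" unfolding cube_add[symmetric] assms(3) by simp
  then show ?thesis using norm_form_nonzero[OF assms(1,2) False] eq_of_add_eq_0 by simp
qed

lemma bij_cube: "bij_betw (\<lambda>x. x ^ 3) F F"
proof -
  have "inj_on (\<lambda>x. x ^ 3) F" using cube_inj by (auto simp: inj_on_def)
  moreover have "(\<lambda>x. x ^ 3) ` F \<subseteq> F" using mult_F by (auto simp: power3_eq_cube)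
  ultimately show ?thesis using finite_F by (simp add: bij_betw_def endo_inj_surj)
qed

abbreviation pts :: "('f \<times> bit) set" where
  "pts \<equiv> F \<times> UNIV"

text \<open>Baker's packing of the lines of \<open>PG(2m - 1, 2)\<close> into spreads: a line \<open>{(x,0), (y,0), (x+y,0)}\<close>
  gets the colour \<open>xy(x+y) = x^3 + y^3 + (x+y)^3\<close>, a line \<open>{(x,1), (y,1), (x+y,0)}\<close> the colour
  \<open>x^3 + y^3\<close>.\<close>

definition line_colour :: "('f \<times> bit) set \<Rightarrow> 'f" where
  "line_colour U = (if \<exists>u\<in>U. snd u = 1 then (\<Sum>u\<in>U. if snd u = 1 then fst u ^ 3 else 0)
     else (\<Sum>u\<in>U. fst u ^ 3))"

text \<open>In characteristic 2 sums are differences, so for a triple this is the line at infinity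
  of its plane, a line of the projective space to which Baker's colouring applies.\<close>

definition directions :: "('f \<times> bit) set \<Rightarrow> ('f \<times> bit) set" where
  "directions T = {a + b |a b. a \<in> T \<and> b \<in> T \<and> a \<noteq> b}"

text \<open>Affine planes over the field of order 2 are the quadruples with sum 0; they are the
  blocks of the quadruple system.\<close>

definition plane :: "('f \<times> bit) set \<Rightarrow> ('f \<times> bit) set" where
  "plane T = insert (\<Sum>T) T"

lemma pt_double [simp]: "(u::'f \<times> bit) + u = 0"
  by (cases u) (simp add: zero_prod_def)

lemma pt_double' [simp]: "(u::'f \<times> bit) + (u + v) = v"
  by (simp flip: add.assoc)

lemma pt_eq_iff: "(u::'f \<times> bit) + v = 0 \<longleftrightarrow> u = v"
  by (metis pt_double pt_double' add.right_neutral)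

lemma pts_add: "u \<in> pts \<Longrightarrow> v \<in> pts \<Longrightarrow> u + v \<in> pts"
  using add_F by (cases u; cases v) auto

lemma line_colour_zero:
  assumes "(d::'f) \<noteq> 0" "v \<noteq> 0" "v \<noteq> (d, 0)" and v: "v = (x, b)"
  shows "line_colour {(d, 0), v, (d, 0) + v} = (if b = 0 then d * x * (x + d) else d * (x\<^sup>2 + x * d + d\<^sup>2))"
proof -
  have cube: "x ^ 3 + (d + x) ^ 3 = d * (x\<^sup>2 + x * d + d\<^sup>2)"
  proof -
    have "(x + (d + x)) = d" by (simp add: add.left_commute)
    moreover have "x\<^sup>2 + x * (d + x) + (d + x)\<^sup>2 = x\<^sup>2 + x * d + d\<^sup>2 + (x\<^sup>2 + x\<^sup>2) + (x * d + x * d)"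
      by (simp add: algebra_simps power2_eq_square del: double double')
    ultimately show ?thesis unfolding cube_add by simp
  qed
  consider "b = 0" | "b = 1" by (cases b)
  then show ?thesis
  proof cases
    case 1
    have "d ^ 3 + d * (x\<^sup>2 + x * d + d\<^sup>2) = d * x * (x + d) + (d ^ 3 + d ^ 3)"
      by (simp add: algebra_simps power2_eq_square power3_eq_cube del: double double')
    then have "d ^ 3 + (x ^ 3 + (d + x) ^ 3) = d * x * (x + d)"
      unfolding cube by simp
    then show ?thesis using assms 1 by (auto simp: line_colour_def zero_prod_def)
  next
    case 2
    then show ?thesis using assms cube by (auto simp: line_colour_def zero_prod_def)
  qed
qed

lemma line_colour_one:
  assumes "v \<noteq> 0" "v \<noteq> (d, 1)" and v: "v = (x, b)"
  shows "line_colour {(d, 1), v, (d, 1) + v} = d ^ 3 + (if b = 1 then x else x + d) ^ 3"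
  using assms by (cases b) (auto simp: line_colour_def zero_prod_def add.commute)

text \<open>At a point (d,0) this rests on the norm form, at (d,1) on injectivity of cubing. A point
  lies on \<open>card F - 1\<close> lines, as many as there are nonzero colours, so with
  \<open>line_colour_inj\<close> every colour class is a spread.\<close>

lemma line_colour_nonzero:
  assumes "u \<in> pts" "v \<in> pts" "u \<noteq> 0" "v \<noteq> 0" "u \<noteq> v"
  shows "line_colour {u, v, u + v} \<in> F - {0}"
proof -
  obtain d a x b where uv: "u = (d, a)" "v = (x, b)" by fastforce
  have F: "d \<in> F" "x \<in> F" "x + d \<in> F" using assms uv add_F by auto
  consider "a = 0" | "a = 1" by (cases a)
  then show ?thesis
  proof cases
    case 1
    then have d: "d \<noteq> 0" using assms uv by (auto simp: zero_prod_def)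
    have "b = 0 \<Longrightarrow> x \<noteq> 0 \<and> x + d \<noteq> 0"
      using assms uv 1 eq_of_add_eq_0[of x d] by (auto simp: zero_prod_def)
    moreover have "x\<^sup>2 + x * d + d\<^sup>2 \<in> F" using F by (simp add: power2_eq_square add_F mult_F)
    ultimately show ?thesis
      using line_colour_zero[OF d assms(4) _ uv(2)] assms uv 1 norm_form_nonzero[OF F(2,1) d] d F mult_F
      by auto
  next
    case 2
    let ?y = "if b = 1 then x else x + d"
    have y: "?y \<in> F" using F by simp
    have "?y \<noteq> d"
      using assms uv 2 by (cases b) (auto simp: zero_prod_def)
    then have "d ^ 3 + ?y ^ 3 \<noteq> 0" using cube_inj[OF F(1) y] eq_of_add_eq_0 by metis
    moreover have "d ^ 3 + ?y ^ 3 \<in> F" using F(1) y by (simp only: power3_eq_cube add_F mult_F)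
    ultimately show ?thesis
      using line_colour_one[OF assms(4) _ uv(2), of d] assms uv 2 by (metis DiffI singletonD)
  qed
qed

text \<open>For \<open>u = (d, 0)\<close>, division of the colour by d leaves x^2 + xd or x^2 + xd +
  d^2, depending on the level of v. With s = x + x', equality gives s^2 + sd = 0, which is the
  claim, or s^2 + sd + d^2 = 0, which the norm form excludes. For \<open>u = (d, 1)\<close> the
  colour is d^3 + y^3, where (y,1) is the other point of level 1 on the line, and cubing is
  injective.\<close>

lemma line_colour_inj:
  assumes u: "u \<in> pts" "u \<noteq> 0" and v: "v \<in> pts" "v \<noteq> 0" "v \<noteq> u"
    and v': "v' \<in> pts" "v' \<noteq> 0" "v' \<noteq> u"
    and eq: "line_colour {u, v, u + v} = line_colour {u, v', u + v'}"
  shows "v' = v \<or> v' = u + v"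
proof -
  obtain d a x b x' b' where uv: "u = (d, a)" "v = (x, b)" "v' = (x', b')" by (cases u; cases v; cases v')
  have F: "d \<in> F" "x \<in> F" "x' \<in> F" "x + d \<in> F" "x' + d \<in> F" "x + x' \<in> F"
    using assms uv add_F by auto
  consider "a = 0" | "a = 1" by (cases a)
  then show ?thesis
  proof cases
    case 1
    then have d: "d \<noteq> 0" using u uv by (auto simp: zero_prod_def)
    define s where "s = x + x'"
    have x': "x' = x + s" by (simp add: s_def)
    have "(if b = 0 then x * (x + d) else x\<^sup>2 + x * d + d\<^sup>2) = (if b' = 0 then x' * (x' + d) else x'\<^sup>2 + x' * d + d\<^sup>2)"
      using eq line_colour_zero[OF d v(2) _ uv(2)] line_colour_zero[OF d v'(2) _ uv(3)] v v' uv 1 d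
      by (auto split: if_splits)
    then have "x\<^sup>2 + x * d + (if b = 0 then 0 else d\<^sup>2) = x'\<^sup>2 + x' * d + (if b' = 0 then 0 else d\<^sup>2)"
      by (auto simp: power2_eq_square algebra_simps split: if_splits)
    then have "(x\<^sup>2 + x * d + (if b = 0 then 0 else d\<^sup>2)) + (x'\<^sup>2 + x' * d + (if b' = 0 then 0 else d\<^sup>2)) = 0"
      by (simp only: double)
    moreover have "x'\<^sup>2 + x' * d = (x\<^sup>2 + x * d) + (s\<^sup>2 + s * d)"
      unfolding x' by (simp add: power2_sum algebra_simps)
    ultimately have s: "s\<^sup>2 + s * d + (if b = b' then 0 else d\<^sup>2) = 0"
      by (cases b; cases b') (simp_all add: ac_simps)
    have "b = b'"
      using norm_form_nonzero[OF _ F(1) d, of s] F(6) s by (auto simp: s_def split: if_splits)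
    then have "s * (s + d) = 0" using s by (simp add: power2_eq_square algebra_simps)
    then have "s = 0 \<or> s = d" using eq_of_add_eq_0 by auto
    then show ?thesis using \<open>b = b'\<close> uv 1 x' by (auto simp: add.commute)
  next
    case 2
    let ?y = "\<lambda>b x. if b = 1 then x else x + d"
    have "d ^ 3 + ?y b x ^ 3 = d ^ 3 + ?y b' x' ^ 3"
      using eq line_colour_one[OF v(2) _ uv(2), of d] line_colour_one[OF v'(2) _ uv(3), of d] v v' uv 2
      by metis
    then have "?y b x = ?y b' x'"
      using cube_inj[of "?y b x" "?y b' x'"] F by (simp split: if_splits)
    then show ?thesis using uv 2 
      by (cases b; cases b') (auto simp: add.commute dest: arg_cong[where f="\<lambda>z. z + d"])
  qed
qed

lemma directions_triple:
  assumes "p \<noteq> q" "p \<noteq> r" "q \<noteq> r"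
  shows "directions {p, q, r} = {p + q, p + r, (p + q) + (p + r)}"
proof -
  have "(p + q) + (p + r) = q + r" by (simp add: ac_simps)
  moreover have "directions {p, q, r} = {p + q, q + p, p + r, r + p, q + r, r + q}"
    using assms unfolding directions_def by blast
  ultimately show ?thesis by (simp only: add.commute[of q p] add.commute[of r p] add.commute[of r q]) blast
qed

lemma plane_triple:
  assumes "p \<noteq> q" "p \<noteq> r" "q \<noteq> r"
  shows "plane {p, q, r} = {p, q, r, p + q + r}"
  using assms by (auto simp: plane_def add.assoc)

text \<open>The cube root renames the colours so that the plane over 0 and d gets the colour d
  itself.\<close>

definition triple_colour :: "('f \<times> bit) set \<Rightarrow> 'f" where
  "triple_colour T = inv_into F (\<lambda>x. x ^ 3) (line_colour (directions T))"

lemma line_colour_directions: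
  assumes "T \<subseteq> pts" "card T = 3"
  shows "line_colour (directions T) \<in> F - {0}"
proof -
  obtain p q r where T: "T = {p, q, r}" "p \<noteq> q" "p \<noteq> r" "q \<noteq> r"
    using assms(2) by (auto simp: card_3_iff)
  have "p + q \<in> pts" "p + r \<in> pts" using assms T by (auto intro: pts_add simp del: mem_Times_iff)
  moreover have "p + q \<noteq> 0" "p + r \<noteq> 0" "p + q \<noteq> p + r" using T by (auto simp: pt_eq_iff)
  ultimately show ?thesis
    using line_colour_nonzero[of "p + q" "p + r"] directions_triple[OF T(2-4)] T(1) by simp
qed

lemma triple_colour_cube:
  assumes "T \<subseteq> pts" "card T = 3"
  shows "triple_colour T ^ 3 = line_colour (directions T)" "triple_colour T \<in> F - {0}"
proof -
  have 1: "line_colour (directions T) \<in> (\<lambda>x. x ^ 3) ` F"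
    using line_colour_directions[OF assms] bij_cube by (auto simp: bij_betw_def)
  show 2: "triple_colour T ^ 3 = line_colour (directions T)"
    unfolding triple_colour_def using f_inv_into_f[OF 1] .
  have "triple_colour T \<in> F" unfolding triple_colour_def using inv_into_into[OF 1] .
  moreover have "triple_colour T \<noteq> 0" using 2 line_colour_directions[OF assms] by auto
  ultimately show "triple_colour T \<in> F - {0}" by simp
qed

text \<open>Two planes through a and b both have a + b at infinity. If their colours are equal, so
  are their lines at infinity, because the lines of one colour form a spread; the planes are then
  parallel and share a.\<close>

theorem resolved_blocks_plane: "resolved_blocks pts plane triple_colour"
  unfolding resolved_blocks_def
proof (intro conjI allI impI)
  fix T assume T: "T \<subseteq> pts \<and> card T = 3"
  then obtain p q r where pqr: "T = {p, q, r}" "p \<noteq> q" "p \<noteq> r" "q \<noteq> r"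
    by (auto simp: card_3_iff)
  have "p + q + r \<notin> {p, q, r}"
  proof -
    have "p + (q + r) \<noteq> p" using pqr pt_eq_iff[of q r] by (metis add.right_neutral add_left_cancel)
    moreover have "q + (p + r) \<noteq> q" using pqr pt_eq_iff[of p r] by (metis add.right_neutral add_left_cancel)
    moreover have "r + (p + q) \<noteq> r" using pqr pt_eq_iff[of p q] by (metis add.right_neutral add_left_cancel)
    ultimately show ?thesis by (auto simp: ac_simps)
  qed
  moreover have "p + q + r \<in> pts" using T pqr by (auto intro!: pts_add simp del: mem_Times_iff)
  ultimately show "T \<subseteq> plane T" "plane T \<subseteq> pts" "card (plane T) = 4"
    using T pqr plane_triple[OF pqr(2-4)] by auto
next
  fix T T' a b
  assume *: "T \<subseteq> pts \<and> card T = 3 \<and> T' \<subseteq> pts \<and> card T' = 3 \<and> a \<noteq> b \<and>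
        {a, b} \<subseteq> T \<inter> T' \<and> triple_colour T = triple_colour T'"
  have third: "\<exists>c. S = {a, b, c} \<and> c \<noteq> a \<and> c \<noteq> b" if "card S = 3" "{a, b} \<subseteq> S" for S :: "('f \<times> bit) set"
  proof -
    have "card (S - {a, b}) = 1" using that * by (simp add: card_Diff_subset)
    then obtain c where "S - {a, b} = {c}" by (auto simp: card_1_singleton_iff)
    then show ?thesis using that(2) by blast
  qed
  obtain c c' where c: "T = {a, b, c}" "c \<noteq> a" "c \<noteq> b" and c': "T' = {a, b, c'}" "c' \<noteq> a" "c' \<noteq> b"
    using third[of T] third[of T'] * by auto
  have "line_colour (directions T) = line_colour (directions T')"
    using triple_colour_cube(1)[of T] triple_colour_cube(1)[of T'] * by simp
  then have eq: "line_colour {a + b, a + c, (a + b) + (a + c)} = line_colour {a + b, a + c', (a + b) + (a + c')}"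
    using directions_triple[of a b c] directions_triple[of a b c'] c c' * by simp
  have pts: "a + b \<in> pts" "a + c \<in> pts" "a + c' \<in> pts" using * c c' by (auto intro!: pts_add simp del: mem_Times_iff)
  have "a + c' = a + c \<or> a + c' = (a + b) + (a + c)"
    by (rule line_colour_inj[OF pts(1) _ pts(2) _ _ pts(3) _ _ eq]) (use * c c' in \<open>auto simp: pt_eq_iff\<close>)
  moreover have "(a + b) + (a + c) = a + (a + b + c)" by (simp add: ac_simps)
  ultimately have "c' = c \<or> c' = a + b + c" by (metis add_left_cancel)
  moreover have "(a + b) + ((a + b) + c) = c" by (rule pt_double')
  ultimately have "{a, b, c', (a + b) + c'} = {a, b, c, (a + b) + c}" by auto
  then show "plane T = plane T'"
    using plane_triple[of a b c] plane_triple[of a b c'] c c' * by simp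
qed

text \<open>The line at infinity is {(0,1), (d,0), (d,1)}, of colour 0 + d^3. These planes are the
  ones through (0,0) and (0,1), which will serve as the two points at infinity, with d standing for
  a point of an affine line.\<close>

lemma infinite_block:
  assumes d: "d \<in> F - {0}" and T: "T \<subseteq> {0, d} \<times> UNIV" "card T = 3"
  shows "plane T = {0, d} \<times> UNIV" "triple_colour T = d"
proof -
  let ?Q = "{0, d} \<times> (UNIV :: bit set)"
  have U: "(UNIV :: bit set) = {0, 1}" by (auto intro: bit.exhaust)
  have Q: "?Q = {(0, 0), (0, 1), (d, 0), (d, 1)}" "card ?Q = 4" using d by (auto simp: U)
  have finQ: "finite ?Q" using Q(1) by simp
  have TX: "T \<subseteq> pts" using T(1) d zero_F by auto
  obtain p q r where pqr: "T = {p, q, r}" "p \<noteq> q" "p \<noteq> r" "q \<noteq> r"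
    using T(2) by (auto simp: card_3_iff)
  have mem: "p \<in> {(0, 0), (0, 1), (d, 0), (d, 1)}" "q \<in> {(0, 0), (0, 1), (d, 0), (d, 1)}"
    "r \<in> {(0, 0), (0, 1), (d, 0), (d, 1)}" using T(1) pqr(1) unfolding Q(1) by auto
  have "plane T \<subseteq> ?Q" unfolding pqr(1) plane_triple[OF pqr(2-4)] Q(1)
    using mem pqr(2-4) d by (auto simp: zero_prod_def)
  moreover have "card (plane T) = 4" using resolved_blocks_plane TX T(2) by (auto simp: resolved_blocks_def)
  ultimately show "plane T = ?Q" using card_seteq[OF finQ] Q(2) by simp
  have "line_colour (directions T) = d ^ 3"
  proof -
    have "p + q \<in> {(0, 1), (d, 0), (d, 1)}" using mem(1,2) pqr(2) by auto
    moreover have "p + r \<in> {(0, 1), (d, 0), (d, 1)}" using mem(1,3) pqr(3) by auto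
    moreover have "p + q \<noteq> p + r" using pqr(4) by simp
    ultimately have "{p + q, p + r, (p + q) + (p + r)} = {(0, 1), (d, 0), (d, 1)}"
      by (elim insertE emptyE) (simp_all add: insert_commute)
    then show ?thesis
      unfolding pqr(1) directions_triple[OF pqr(2-4)] using d by (simp add: line_colour_def)
  qed
  then have "triple_colour T ^ 3 = d ^ 3" using triple_colour_cube[OF TX T(2)] by simp
  then show "triple_colour T = d" using cube_inj triple_colour_cube[OF TX T(2)] d by blast
qed

end

section \<open>Fields of order 2^k inside the algebraic closure of the field of order 2\<close>

lemma gf2_power_add:
  fixes x y :: "'f::comm_ring_1"
  assumes char2: "(1::'f) + 1 = 0"
  shows "(x + y) ^ (2 ^ k) = x ^ (2 ^ k) + y ^ (2 ^ k)"
proof (induction k)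
  case (Suc k)
  have "(2::'f) = 0" using char2 by simp
  then have sq: "(a + b)\<^sup>2 = a\<^sup>2 + b\<^sup>2" for a b :: 'f
    by (simp add: power2_sum)
  have "z ^ (2 ^ Suc k) = (z ^ (2 ^ k))\<^sup>2" for z :: 'f
    unfolding power_Suc2 power_mult ..
  then show ?case by (simp only: Suc.IH sq)
qed simp

text \<open>The polynomial X^(2^k) - X splits and has derivative -1, so its 2^k roots are
  distinct.\<close>

lemma card_gf2:
  fixes F :: "'f::alg_closed_field set"
  assumes char2: "(1::'f) + 1 = 0" and k: "k > 0"
  defines "F \<equiv> {x. x ^ (2 ^ k) = x}"
  shows "finite F" "card F = 2 ^ k"
proof -
  define N :: nat where "N = 2 ^ k"
  have N: "N > 1" using k one_less_power[of "2::nat" k] by (simp add: N_def)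
  define P :: "'f poly" where "P = monom 1 N - monom 1 1"
  have deg: "degree P = N"
    unfolding P_def diff_conv_add_uminus using N
    by (subst degree_add_eq_left) (auto simp: degree_monom_eq)
  have P0: "P \<noteq> 0" using deg N by auto
  have root: "poly P x = 0 \<longleftrightarrow> x \<in> F" for x
    by (simp add: P_def poly_monom F_def N_def)
  have "of_nat N = (0::'f)"
    using char2 k by (cases k) (simp_all add: N_def)
  then have der: "pderiv P = - 1"
    unfolding P_def pderiv_diff pderiv_monom by simp
  obtain A where A: "size A = degree P" "P = smult (lead_coeff P) (\<Prod>x\<in>#A. [:-x, 1:])"
    using alg_closed_imp_factorization[OF P0] by blast
  \<comment> \<open>A repeated root would also be a root of the derivative.\<close>
  have cnt: "count A x \<le> 1" for x
  proof (rule ccontr)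
    assume "\<not> count A x \<le> 1"
    then have "{#x, x#} \<subseteq># A" by (simp add: mset_subset_eq_count subseteq_mset_def)
    then obtain B where "A = {#x, x#} + B" by (metis subset_mset.add_diff_inverse)
    then have "P = [:-x, 1:] * ([:-x, 1:] * smult (lead_coeff P) (\<Prod>x\<in>#B. [:-x, 1:]))"
      by (subst A(2)) (simp add: mult_ac)
    then obtain R where "P = [:-x, 1:] * ([:-x, 1:] * R)" by blast
    moreover have "poly (pderiv ([:-x, 1:] * Q)) x = poly Q x" for Q
      unfolding pderiv_mult poly_add poly_mult by (simp add: pderiv_pCons)
    ultimately have "poly (pderiv P) x = 0" by (simp only: poly_mult) simp
    then show False by (simp add: der)
  qed
  have "poly P x = 0 \<longleftrightarrow> x \<in># A" for x
    by (subst A(2)) (auto simp: poly_prod_mset prod_mset_zero_iff P0)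
  then have F: "F = set_mset A" using root by blast
  then show "finite F" by simp
  have "size A = (\<Sum>x\<in>set_mset A. count A x)" by (simp add: size_multiset_overloaded_eq)
  also have "\<dots> = (\<Sum>x\<in>set_mset A. 1)"
    by (rule sum.cong) (use cnt in \<open>auto simp: le_Suc_eq count_eq_zero_iff\<close>)
  finally show "card F = 2 ^ k" using A(1) deg F by (simp add: N_def)
qed

text \<open>A root x of t^2 + t + 1 has x^3 = 1, and 2^k is 2 modulo 3 for odd k. Membership in
  \<open>F\<close> would thus mean x^2 = x, and then x^2 + x + 1 = 1.\<close>

lemma odd_gf2_exists:
  assumes k: "odd k"
  defines "F \<equiv> {x :: bit alg_closure. x ^ (2 ^ k) = x}"
  shows "odd_gf2 F" "card F = 2 ^ k"
proof -
  have "to_ac (1 + 1 :: bit) = (0 :: bit alg_closure)" by simp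
  then have char2: "(1 :: bit alg_closure) + 1 = 0" by (simp only: to_ac_add to_ac_1)
  have k0: "k > 0" using k by (cases k) auto
  note F = card_gf2[OF char2 k0, folded F_def]
  show "card F = 2 ^ k" by (rule F(2))
  show "odd_gf2 F"
  proof
    show "finite F" by (rule F(1))
    show "(1 :: bit alg_closure) + 1 = 0" by (rule char2)
    show "1 \<in> F" by (simp add: F_def)
    show "x + y \<in> F" if "x \<in> F" "y \<in> F" for x y
      using that by (simp add: F_def gf2_power_add[OF char2])
    show "x * y \<in> F" if "x \<in> F" "y \<in> F" for x y
      using that by (simp add: F_def power_mult_distrib)
    show "inverse x \<in> F" if "x \<in> F" for x
      using that by (simp add: F_def power_inverse)
    show "x\<^sup>2 + x + 1 \<noteq> 0" if "x \<in> F" for x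
    proof
      assume x: "x\<^sup>2 + x + 1 = 0"
      have "x ^ 3 = (x - 1) * (x\<^sup>2 + x + 1) + 1"
        by (simp add: algebra_simps power2_eq_square power3_eq_cube)
      then have "x ^ 3 = 1" unfolding x by simp
      obtain j where j: "k = 2 * j + 1" using k by (auto elim: oddE)
      have "(2::nat) ^ k mod 3 = 2"
      proof -
        have "(4::nat) ^ j mod 3 = 1" by (induction j) (simp_all add: mod_mult_right_eq[symmetric, of 4])
        then show ?thesis unfolding j by (simp add: power_mult power_add mod_mult_right_eq[symmetric, of 2])
      qed
      then obtain i where "(2::nat) ^ k = 3 * i + 2" by (metis mult_div_mod_eq)
      then have "x ^ (2 ^ k) = x\<^sup>2" using \<open>x ^ 3 = 1\<close> by (simp add: power_add power_mult power2_eq_square)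
      then have "x\<^sup>2 = x" using that by (simp add: F_def)
      then have "x + x = - 1" using x by (simp add: eq_neg_iff_add_eq_0 add.assoc)
      moreover have "x + x = (1 + 1) * x" by (simp add: distrib_right)
      ultimately show False unfolding char2 by simp
    qed
  qed
qed

section \<open>Colourings from resolved blocks\<close>

text \<open>Identify the four points of a block with the field of order 4, in the order \<open>(0,0), (0,1), (1,0), (1,1)\<close>.
  A word that vanishes exactly at \<open>z\<close> and has sign bits \<open>s i\<close> elsewhere gets the colour
  \<open>\<omega> z + (\<Sum>i \<noteq> z. s i (z + i))\<close>.
  In the definition \<open>za\<close>, \<open>sa\<close>, ... say whether the entry is 0 and whether it is 2.\<close>

definition tetra_colour :: "bool \<Rightarrow> bool \<Rightarrow> bool \<Rightarrow> bool \<Rightarrow> bool \<Rightarrow> bool \<Rightarrow> bool \<Rightarrow> bool \<times> bool" where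
  "tetra_colour za zb zc sa sb sc sd =
    (if za then (sc \<noteq> sd, sb \<noteq> sd)
     else if zb then (sc = sd, sa = sc)
     else if zc then (sa \<noteq> sb, sb = sd)
     else (sa = sb, sa \<noteq> sc))"

text \<open>Read (0,1) as 1 and (1,1) as \<omega>. If distinct words vanish at the same z and agree
  somewhere else, their colours differ by a sum of one or two of the three nonzero elements z + i,
  which is not 0. If they vanish at z and z' and agree at the other two places, the colours differ
  by (z + z')(\<omega> + b) for a bit b, and \<omega> is not a bit. Here \<open>ea\<close>,
  \<open>eb\<close>, ... express a common nonzero entry.\<close>

lemma tetra_colour_separates:
  assumes "za \<and> \<not> zb \<and> \<not> zc \<and> \<not> zd \<or> \<not> za \<and> zb \<and> \<not> zc \<and> \<not> zd \<or> \<not> za \<and> \<not> zb \<and> zc \<and> \<not> zd \<or> \<not> za \<and> \<not> zb \<and> \<not> zc \<and> zd"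
    and "za' \<and> \<not> zb' \<and> \<not> zc' \<and> \<not> zd' \<or> \<not> za' \<and> zb' \<and> \<not> zc' \<and> \<not> zd' \<or> \<not> za' \<and> \<not> zb' \<and> zc' \<and> \<not> zd' \<or> \<not> za' \<and> \<not> zb' \<and> \<not> zc' \<and> zd'"
    and "tetra_colour za zb zc sa sb sc sd = tetra_colour za' zb' zc' sa' sb' sc' sd'"
    and ea: "ea \<longleftrightarrow> \<not> za \<and> \<not> za' \<and> sa = sa'" and eb: "eb \<longleftrightarrow> \<not> zb \<and> \<not> zb' \<and> sb = sb'"
    and ec: "ec \<longleftrightarrow> \<not> zc \<and> \<not> zc' \<and> sc = sc'" and ed: "ed \<longleftrightarrow> \<not> zd \<and> \<not> zd' \<and> sd = sd'"
    and "za = za' \<and> zb = zb' \<and> zc = zc' \<and> zd = zd' \<and> (ea \<or> eb \<or> ec \<or> ed) \<or>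
      ea \<and> eb \<or> ea \<and> ec \<or> ea \<and> ed \<or> eb \<and> ec \<or> eb \<and> ed \<or> ec \<and> ed"
  shows "(ea \<or> za \<and> za') \<and> (eb \<or> zb \<and> zb') \<and> (ec \<or> zc \<and> zc') \<and> (ed \<or> zd \<and> zd')"
proof (rule ccontr)
  have c1: "fst (tetra_colour za zb zc sa sb sc sd) = fst (tetra_colour za' zb' zc' sa' sb' sc' sd')"
   and c2: "snd (tetra_colour za zb zc sa sb sc sd) = snd (tetra_colour za' zb' zc' sa' sb' sc' sd')" using assms(3) by simp_all
  have t1: "fst (tetra_colour za zb zc sa sb sc sd) = ((za \<and> (sc \<noteq> sd)) \<or> (\<not>za \<and> zb \<and> sc = sd) \<or> (\<not>za \<and> \<not>zb \<and> zc \<and> (sa\<noteq>sb)) \<or> (\<not>za\<and>\<not>zb\<and>\<not>zc\<and>(sa=sb)))" for za zb zc sa sb sc sd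
     by (simp add: tetra_colour_def)
  have t2: "snd (tetra_colour za zb zc sa sb sc sd) = ((za \<and> (sb \<noteq> sd)) \<or> (\<not>za \<and> zb \<and> sa = sc) \<or> (\<not>za \<and> \<not>zb \<and> zc \<and> (sb=sd)) \<or> (\<not>za\<and>\<not>zb\<and>\<not>zc\<and>(sa\<noteq>sc)))" for za zb zc sa sb sc sd
     by (simp add: tetra_colour_def)
  assume "\<not> ((ea \<or> za \<and> za') \<and> (eb \<or> zb \<and> zb') \<and> (ec \<or> zc \<and> zc') \<and> (ed \<or> zd \<and> zd'))"
  then show False using assms(1,2,4-8) c1 c2 unfolding t1 t2 by sat
qed

lemma ex_tetra_colouring:
  assumes "card Q = 4"
  shows "\<exists>f :: ('a \<Rightarrow> nat) \<Rightarrow> bool \<times> bool. proper_on Q f"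
proof -
  obtain p q r s where Q: "Q = {p, q, r, s}" and d: "distinct [p, q, r, s]"
  proof -
    obtain p A where "Q = insert p A" "p \<notin> A" "card A = 3"
      using assms card_Suc_eq[of Q 3] by auto
    moreover then obtain q r s where "A = {q, r, s}" "q \<noteq> r" "q \<noteq> s" "r \<noteq> s"
      by (auto simp: card_3_iff)
    ultimately show ?thesis by (intro that[of p q r s]) auto
  qed
  \<comment> \<open>Exactly one entry on \<open>Q\<close> is 0, so three zero tests locate
    it.\<close>
  define f where "f w = tetra_colour (w p = 0) (w q = 0) (w r = 0) (w p = 2) (w q = 2) (w r = 2) (w s = 2)"
    for w :: "'a \<Rightarrow> nat"
  have one: "w p = 0 \<and> w q \<noteq> 0 \<and> w r \<noteq> 0 \<and> w s \<noteq> 0 \<or> w p \<noteq> 0 \<and> w q = 0 \<and> w r \<noteq> 0 \<and> w s \<noteq> 0 \<or>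
      w p \<noteq> 0 \<and> w q \<noteq> 0 \<and> w r = 0 \<and> w s \<noteq> 0 \<or> w p \<noteq> 0 \<and> w q \<noteq> 0 \<and> w r \<noteq> 0 \<and> w s = 0"
    if "w \<in> signed_triples Q" for w
  proof -
    have sub: "supp w \<subseteq> Q" and c: "card (supp w) = 3" using that by (auto simp: signed_triples_def)
    have "finite Q" using Q by simp
    then have "card (Q - supp w) = 1" using sub c assms by (simp add: card_Diff_subset finite_subset)
    then obtain z where "Q - supp w = {z}" by (auto simp: card_1_singleton_iff)
    then have "w a = 0 \<longleftrightarrow> a = z" if "a \<in> Q" for a using that unfolding supp_def by blast
    moreover have "z \<in> Q" using \<open>Q - supp w = {z}\<close> by blast
    ultimately show ?thesis using d unfolding Q by auto
  qed
  have eq_iff: "w a = v a \<longleftrightarrow> (w a = 0 \<longleftrightarrow> v a = 0) \<and> (w a = 2 \<longleftrightarrow> v a = 2)"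
    if "w \<in> signed_triples Q" "v \<in> signed_triples Q" for w v a
  proof -
    have "w a < 3" "v a < 3" using that by (auto simp: signed_triples_def)
    then show ?thesis by (auto simp: less_Suc_eq numeral_3_eq_3)
  qed
  have "f w \<noteq> f v" if wv: "w \<in> signed_triples Q" "v \<in> signed_triples Q" and cl: "clash w v" for w v
  proof
    assume eq: "f w = f v"
    define e where "e a \<longleftrightarrow> w a \<noteq> 0 \<and> v a \<noteq> 0 \<and> (w a = 2 \<longleftrightarrow> v a = 2)" for a
    have e: "e a \<longleftrightarrow> w a \<noteq> 0 \<and> w a = v a" for a
      unfolding e_def eq_iff[OF wv, of a] by (cases "w a = 0"; cases "v a = 0"; simp)
    have sw: "a \<in> supp w \<Longrightarrow> a \<in> {p, q, r, s}" for a using wv Q by (auto simp: signed_triples_def)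
    have "(w p = 0) = (v p = 0) \<and> (w q = 0) = (v q = 0) \<and> (w r = 0) = (v r = 0) \<and> (w s = 0) = (v s = 0) \<and> (e p \<or> e q \<or> e r \<or> e s) \<or>
      e p \<and> e q \<or> e p \<and> e r \<or> e p \<and> e s \<or> e q \<and> e r \<or> e q \<and> e s \<or> e r \<and> e s"
      using cl unfolding clash_def
    proof (elim conjE disjE bexE)
      fix a assume a: "supp w = supp v" "a \<in> supp w" "w a = v a"
      have "w b = 0 \<longleftrightarrow> v b = 0" for b using a(1) unfolding supp_def by blast
      moreover have "e a" using a unfolding e by (simp add: supp_def)
      ultimately show ?thesis using sw[OF a(2)] by blast
    next
      fix a b assume ab: "a \<in> supp w" "b \<in> supp w" "a \<noteq> b" "w a = v a" "w b = v b"
      then have "e a" "e b" unfolding e by (simp_all add: supp_def)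
      then show ?thesis using sw[OF ab(1)] sw[OF ab(2)] ab(3) by blast
    qed
    from tetra_colour_separates[OF one[OF wv(1)] one[OF wv(2)] eq[unfolded f_def] _ _ _ _ this]
    have "(e p \<or> w p = 0 \<and> v p = 0) \<and> (e q \<or> w q = 0 \<and> v q = 0) \<and> (e r \<or> w r = 0 \<and> v r = 0) \<and> (e s \<or> w s = 0 \<and> v s = 0)"
      by (simp add: e_def)
    then have "w a = v a" if "a \<in> Q" for a using that unfolding Q by (auto simp: e)
    moreover have "w a = v a" if "a \<notin> Q" for a
    proof -
      have "a \<notin> supp w" "a \<notin> supp v" using that wv by (auto simp: signed_triples_def)
      then show ?thesis by (simp add: supp_def)
    qed
    ultimately have "w = v" by blast
    then show False using cl by (simp add: clash_def)
  qed
  then show ?thesis unfolding proper_on_def by blast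
qed

lemma clash_common_pair:
  assumes "clash w v" "card (supp w) = 3"
  shows "\<exists>a b. a \<noteq> b \<and> {a, b} \<subseteq> supp w \<inter> supp v"
proof (cases "supp w = supp v")
  case True
  obtain a b c where "supp w = {a, b, c}" "a \<noteq> b" using assms(2) by (auto simp: card_3_iff)
  then show ?thesis using True by (intro exI[of _ a] exI[of _ b]) simp
next
  case False
  then obtain a b where "a \<in> supp w" "b \<in> supp w" "a \<noteq> b" "w a = v a" "w b = v b"
    using assms(1) by (auto simp: clash_def)
  then show ?thesis by (intro exI[of _ a] exI[of _ b]) (auto simp: supp_def)
qed

text \<open>The choice depends on the block alone, so all words on one block are compared under the
  same tiling.\<close>

definition block_colour :: "'a set \<Rightarrow> ('a \<Rightarrow> nat) \<Rightarrow> bool \<times> bool" where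
  "block_colour Q = (SOME f. proper_on Q f)"

lemma block_colour_separates:
  assumes "clash w v" "w \<in> signed_triples pts" "v \<in> signed_triples pts"
    and "supp w \<subseteq> Q" "supp v \<subseteq> Q" "card Q = 4"
  shows "block_colour Q w \<noteq> block_colour Q v"
proof -
  have "proper_on Q (block_colour Q)"
    unfolding block_colour_def using ex_tetra_colouring[OF assms(6)] by (rule someI_ex)
  moreover have "w \<in> signed_triples Q" "v \<in> signed_triples Q"
    using assms by (auto simp: signed_triples_def)
  ultimately show ?thesis using assms(1) by (auto simp: proper_on_def)
qed

lemma proper_on_of_resolved_blocks:
  assumes "resolved_blocks pts blk cls"
  shows "proper_on pts (\<lambda>w. (cls (supp w), block_colour (blk (supp w)) w))"
  unfolding proper_on_def
proof (intro ballI impI notI)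
  fix w v assume wv: "w \<in> signed_triples pts" "v \<in> signed_triples pts" and cl: "clash w v"
    and eq: "(cls (supp w), block_colour (blk (supp w)) w) = (cls (supp v), block_colour (blk (supp v)) v)"
  have T: "supp w \<subseteq> pts" "card (supp w) = 3" "supp v \<subseteq> pts" "card (supp v) = 3"
    using wv by (auto simp: signed_triples_def)
  obtain a b where "a \<noteq> b" "{a, b} \<subseteq> supp w \<inter> supp v"
    using clash_common_pair[OF cl T(2)] by blast
  then have "blk (supp w) = blk (supp v)"
    using resolved_blocks_eq[OF assms T] eq by simp
  then show False
    using block_colour_separates[OF cl wv, of "blk (supp w)"] eq
      resolved_blocks_block[OF assms T(1,2)] resolved_blocks_block[OF assms T(3,4)] by simp
qed

section \<open>Linear spaces\<close>

definition line_points :: "'v set \<Rightarrow> ('v option \<times> bit) set" where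
  "line_points L = insert None (Some ` L) \<times> UNIV"

definition fibre :: "'v \<Rightarrow> ('v option \<times> bit) set" where
  "fibre x = {None, Some x} \<times> UNIV"

lemma UNIV_bit: "(UNIV :: bit set) = {0, 1}"
  by (auto intro: bit.exhaust)

lemma card_fibre: "card (fibre x) = 4" "finite (fibre x)"
  by (auto simp: fibre_def UNIV_bit)

lemma fibre_subset: "x \<in> L \<Longrightarrow> fibre x \<subseteq> line_points L"
  by (auto simp: fibre_def line_points_def)

lemma resolved_blocks_transport:
  assumes res: "resolved_blocks pts blk cls" and g: "bij_betw g Y pts"
  shows "resolved_blocks Y (\<lambda>T. {a \<in> Y. g a \<in> blk (g ` T)}) (\<lambda>T. cls (g ` T))"
proof -
  have inj: "inj_on g Y" and im: "g ` Y = pts" using g by (auto simp: bij_betw_def)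
  have T: "g ` T \<subseteq> pts" "card (g ` T) = 3" if "T \<subseteq> Y" "card T = 3" for T
    using that inj im by (auto simp: card_image inj_on_subset)
  show ?thesis
    unfolding resolved_blocks_def
  proof (intro conjI allI impI)
    fix T assume *: "T \<subseteq> Y \<and> card T = 3"
    note blk = resolved_blocks_block[OF res T, of T]
    show "T \<subseteq> {a \<in> Y. g a \<in> blk (g ` T)}" using blk * by auto
    show "{a \<in> Y. g a \<in> blk (g ` T)} \<subseteq> Y" by blast
    have "g ` {a \<in> Y. g a \<in> blk (g ` T)} = blk (g ` T)" using blk(2) * im by blast
    then show "card {a \<in> Y. g a \<in> blk (g ` T)} = 4"
      using blk(3) * card_image[OF inj_on_subset[OF inj, of "{a \<in> Y. g a \<in> blk (g ` T)}"]] by force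
  next
    fix T T' a b
    assume *: "T \<subseteq> Y \<and> card T = 3 \<and> T' \<subseteq> Y \<and> card T' = 3 \<and> a \<noteq> b \<and> {a, b} \<subseteq> T \<inter> T' \<and> cls (g ` T) = cls (g ` T')"
    have "g a \<noteq> g b" using * inj by (auto simp: inj_on_def)
    then have "blk (g ` T) = blk (g ` T')"
      using resolved_blocks_eq[OF res T T, of T T' "g a" "g b"] * by blast
    then show "{a \<in> Y. g a \<in> blk (g ` T)} = {a \<in> Y. g a \<in> blk (g ` T')}" by simp
  qed
qed

text \<open>Infinity is sent to 0 and the points of L bijectively to the nonzero elements, and the
  planes are pulled back. The last clause is \<open>infinite_block\<close>; it makes the systems of
  different lines through x agree on the fibre of x.\<close>

lemma (in odd_gf2) ex_line_blocks:
  assumes L: "finite L" "card L + 1 = card F"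
  shows "\<exists>blk cls. resolved_blocks (line_points L) blk cls \<and>
    (\<forall>T. T \<subseteq> line_points L \<and> card T = 3 \<longrightarrow> cls T \<in> L) \<and>
    (\<forall>x\<in>L. \<forall>T. T \<subseteq> fibre x \<and> card T = 3 \<longrightarrow> blk T = fibre x \<and> cls T = x)"
proof -
  have "card L = card (F - {0})" using L finite_F zero_F by simp
  then obtain h where h: "bij_betw h L (F - {0})"
    using finite_same_card_bij[OF L(1), of "F - {0}"] finite_F by auto
  define g where "g = map_prod (case_option 0 h) (id :: bit \<Rightarrow> bit)"
  have g: "bij_betw g (line_points L) pts"
  proof -
    have "inj_on (case_option 0 h) (insert None (Some ` L))"
      using h by (auto simp: inj_on_def bij_betw_def)
    moreover have "case_option 0 h ` insert None (Some ` L) = F"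
      unfolding image_insert image_image using h zero_F by (auto simp: bij_betw_def)
    ultimately show ?thesis
      unfolding g_def line_points_def bij_betw_def by (simp add: map_prod_inj_on map_prod_surj_on)
  qed
  define blk where "blk T = {a \<in> line_points L. g a \<in> plane (g ` T)}" for T
  define cls where "cls T = inv_into L h (triple_colour (g ` T))" for T
  have inj: "inj_on g (line_points L)" and im: "g ` line_points L = pts" using g by (auto simp: bij_betw_def)
  have gT: "g ` T \<subseteq> pts" "card (g ` T) = 3" if "T \<subseteq> line_points L" "card T = 3" for T
    using that inj im by (auto simp: card_image inj_on_subset)
  have hL: "h ` L = F - {0}" using h by (simp add: bij_betw_def)
  have cls_h: "h (cls T) = triple_colour (g ` T)" "cls T \<in> L" if "T \<subseteq> line_points L" "card T = 3" for T
    using triple_colour_cube(2)[OF gT[OF that]] unfolding hL[symmetric] cls_def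
    by (rule f_inv_into_f, rule inv_into_into)
  have res: "resolved_blocks (line_points L) blk (\<lambda>T. triple_colour (g ` T))"
    unfolding blk_def by (rule resolved_blocks_transport[OF resolved_blocks_plane g])
  have "resolved_blocks (line_points L) blk cls"
    unfolding resolved_blocks_def
  proof (intro conjI allI impI)
    fix T T' a b
    assume *: "T \<subseteq> line_points L \<and> card T = 3 \<and> T' \<subseteq> line_points L \<and> card T' = 3 \<and> a \<noteq> b \<and>
        {a, b} \<subseteq> T \<inter> T' \<and> cls T = cls T'"
    then have "triple_colour (g ` T) = triple_colour (g ` T')" using cls_h(1) by metis
    then show "blk T = blk T'" using resolved_blocks_eq[OF res, of T T' a b] * by blast
  qed (blast dest: resolved_blocks_block[OF res])+
  moreover have "blk T = fibre x \<and> cls T = x" if x: "x \<in> L" and T: "T \<subseteq> fibre x" "card T = 3" for x T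
  proof -
    have TL: "T \<subseteq> line_points L" using fibre_subset[OF x] T by blast
    have gf: "g ` fibre x = {0, h x} \<times> UNIV" by (force simp: g_def fibre_def)
    have d: "h x \<in> F - {0}" using x hL by blast
    note ib = infinite_block[OF d _ gT(2)[OF TL T(2)]]
    have "g ` T \<subseteq> {0, h x} \<times> UNIV" using T(1) gf by blast
    note ib = ib[OF this]
    have "cls T = x"
      using cls_h[OF TL T(2)] ib(2) h x by (auto simp: bij_betw_def inj_on_def)
    moreover have "blk T = fibre x"
      unfolding blk_def ib(1) gf[symmetric]
      using inj fibre_subset[OF x] by (auto simp: inj_on_def)
    ultimately show ?thesis by blast
  qed
  ultimately show ?thesis using cls_h(2) by blast
qed

section \<open>Words over three distinct affine points\<close>

definition shadow :: "('v option \<times> bit) set \<Rightarrow> 'v set" where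
  "shadow T = {x. \<exists>b. (Some x, b) \<in> T}"

definition level :: "('v option \<times> bit \<Rightarrow> nat) \<Rightarrow> 'v \<Rightarrow> bool" where
  "level w x \<longleftrightarrow> w (Some x, 1) \<noteq> 0"

definition sign :: "('v option \<times> bit \<Rightarrow> nat) \<Rightarrow> 'v \<Rightarrow> bool" where
  "sign w x \<longleftrightarrow> w (Some x, 0) = 2 \<or> w (Some x, 1) = 2"

text \<open>With the labels \<open>l i = (level, sign)\<close> in the plane over the field of order 2, this is
  \<open>A 1 (l 1) + A 2 (l 2) + A 3 (l 3)\<close> for invertible matrices \<open>A i\<close> that map \<open>(0, 1)\<close> to three
  different vectors, so that changing the signs at two places changes the colour.\<close>

definition cube_colour :: "('v option \<times> bit \<Rightarrow> nat) \<Rightarrow> bool \<times> bool" where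
  "cube_colour w = (case SOME (x, y, z). shadow (supp w) = {x, y, z} of (x, y, z) \<Rightarrow>
     ((level w x \<noteq> sign w y) \<noteq> (level w z \<noteq> sign w z), (sign w x \<noteq> level w y) \<noteq> sign w z))"

lemma subset_line_points:
  assumes "T \<subseteq> line_points V" "shadow T \<subseteq> L"
  shows "T \<subseteq> line_points L"
proof
  fix a assume a: "a \<in> T"
  obtain t b where t: "a = (t, b)" by fastforce
  show "a \<in> line_points L"
  proof (cases t)
    case (Some x)
    then have "x \<in> shadow T" using a t by (auto simp: shadow_def)
    then show ?thesis using assms(2) t Some by (auto simp: line_points_def)
  qed (simp add: t line_points_def)
qed

text \<open>With equal supports the levels agree, and so does at least one sign; the colours then
  differ by a sum of one or two of three distinct nonzero vectors. With two common entries, two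
  labels agree and the third matrix, being invertible, separates the remaining labels.\<close>

lemma cube_colour_separates:
  assumes w: "w \<in> signed_triples S" "shadow (supp w) = N" and v: "v \<in> signed_triples S" "shadow (supp v) = N"
    and N: "card N = 3" and no_inf: "\<And>b. (None, b) \<notin> supp w" "\<And>b. (None, b) \<notin> supp v"
    and cl: "clash w v"
  shows "cube_colour w \<noteq> cube_colour v"
proof
  assume eq: "cube_colour w = cube_colour v"
  obtain x0 y0 z0 where "N = {x0, y0, z0}" using N by (auto simp: card_3_iff)
  then have "case (x0, y0, z0) of (x, y, z) \<Rightarrow> N = {x, y, z}" by simp
  then have "case SOME (x, y, z). N = {x, y, z} of (x, y, z) \<Rightarrow> N = {x, y, z}"
    by (rule someI[where P = "\<lambda>(x, y, z). N = {x, y, z}"])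
  \<comment> \<open>The enumeration is chosen from \<open>N\<close> alone, so both words are read in
    the same order.\<close>
  then obtain x y z where some: "(SOME (x, y, z). N = {x, y, z}) = (x, y, z)" and xyz: "N = {x, y, z}"
    by (cases "SOME (x, y, z). N = {x, y, z}") auto
  have eqs: "((level w x \<noteq> sign w y) \<noteq> (level w z \<noteq> sign w z)) = ((level v x \<noteq> sign v y) \<noteq> (level v z \<noteq> sign v z))"
    "((sign w x \<noteq> level w y) \<noteq> sign w z) = ((sign v x \<noteq> level v y) \<noteq> sign v z)"
    using eq unfolding cube_colour_def w(2) v(2) some by simp_all
  \<comment> \<open>Three support points project onto three affine points, hence one lies over each;
    level and sign then determine the word.\<close>
  have one_point: "u (Some t, 0) = 0 \<longleftrightarrow> u (Some t, 1) \<noteq> 0" "u (Some t, b) < 3"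
    if u: "u \<in> signed_triples S" "shadow (supp u) = N" and t: "t \<in> N" and ni: "\<And>b. (None, b) \<notin> supp u" for u t b
  proof -
    have c: "card (supp u) = 3" "finite (supp u)" using u(1) by (auto simp: signed_triples_def intro: card_ge_0_finite)
    let ?f = "\<lambda>a. the (fst a)"
    have im: "?f ` supp u = N"
    proof
      show "?f ` supp u \<subseteq> N"
      proof
        fix s assume "s \<in> ?f ` supp u"
        then obtain o' b where "(o', b) \<in> supp u" "s = the o'" by auto
        then show "s \<in> N" using ni u(2) by (cases o') (auto simp: shadow_def)
      qed
      show "N \<subseteq> ?f ` supp u" unfolding u(2)[symmetric] shadow_def by force
    qed
    then have inj: "inj_on ?f (supp u)" using c N by (intro eq_card_imp_inj_on) auto
    have "\<not> ((Some t, 0) \<in> supp u \<and> (Some t, 1) \<in> supp u)"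
      using inj_onD[OF inj, of "(Some t, 0)" "(Some t, 1)"] by auto
    moreover have "\<exists>b. (Some t, b) \<in> supp u" using t u(2) by (auto simp: shadow_def)
    then have "(Some t, 0) \<in> supp u \<or> (Some t, 1) \<in> supp u" by (metis bit.exhaust)
    ultimately show "u (Some t, 0) = 0 \<longleftrightarrow> u (Some t, 1) \<noteq> 0" by (auto simp: supp_def)
    show "u (Some t, b) < 3" using u(1) by (simp add: signed_triples_def)
  qed
  define E where "E t \<longleftrightarrow> level w t = level v t \<and> sign w t = sign v t" for t
  have E1: "\<forall>b. w (Some t, b) = v (Some t, b)" if "t \<in> N" "E t" for t
  proof
    fix b
    note 1 = one_point[OF w that(1) no_inf(1)] one_point[OF v that(1) no_inf(2)]
    have "u = (0::nat) \<or> u = 1 \<or> u = 2" if "u < 3" for u using that by linarith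
    note 2 = this[OF 1(2)[of 0]] this[OF 1(2)[of 1]] this[OF 1(4)[of 0]] this[OF 1(4)[of 1]]
    show "w (Some t, b) = v (Some t, b)"
      using that(2) 1(1,3) 2 unfolding E_def level_def sign_def by (cases b) (elim disjE; simp)+
  qed
  have E2: "t \<in> N \<and> E t" if "w (Some t, b) = v (Some t, b)" "(Some t, b) \<in> supp w" for t b
  proof -
    have t: "t \<in> N" using that(2) w(2) by (auto simp: shadow_def)
    note 1 = one_point(1)[OF w t no_inf(1)] one_point(1)[OF v t no_inf(2)]
    have "w (Some t, b) \<noteq> 0" using that(2) by (simp add: supp_def)
    then have "E t" using 1 that(1) unfolding E_def level_def sign_def by (cases b) auto
    then show ?thesis using t by blast
  qed
  have wv: "\<not> (E x \<and> E y \<and> E z)"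
  proof
    assume "E x \<and> E y \<and> E z"
    then have *: "w (Some t, b) = v (Some t, b)" if "t \<in> N" for t b using E1 that xyz by blast
    have "w a = v a" for a
    proof (cases "\<exists>t\<in>N. \<exists>b. a = (Some t, b)")
      case False
      obtain o' b where a: "a = (o', b)" by fastforce
      have "a \<notin> supp u" if "shadow (supp u) = N" "\<And>b. (None, b) \<notin> supp u" for u
        using that False a by (cases o') (auto simp: shadow_def)
      then have "a \<notin> supp w" "a \<notin> supp v" using w(2) v(2) no_inf by blast+
      then show ?thesis by (simp add: supp_def)
    qed (use * in blast)
    then show False using cl by (auto simp: clash_def)
  qed
  have point: "\<exists>t b. a = (Some t, b)" if "a \<in> supp w" for a
    using no_inf(1) that by (metis option.exhaust surj_pair)
  from cl consider (same) "supp w = supp v" "\<exists>a\<in>supp w. w a = v a"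
    | (two) a b where "a \<in> supp w" "b \<in> supp w" "a \<noteq> b" "w a = v a" "w b = v b"
    unfolding clash_def by blast
  then show False
  proof cases
    case same
    then obtain a where "a \<in> supp w" "w a = v a" by blast
    then obtain t where "t \<in> N" "E t" using E2 point by metis
    then have "E x \<or> E y \<or> E z" using xyz by blast
    moreover have lev: "level w t = level v t" for t
    proof -
      have "(Some t, 1) \<in> supp w \<longleftrightarrow> (Some t, 1) \<in> supp v" using same(1) by simp
      then show ?thesis by (simp add: level_def supp_def)
    qed
    ultimately show False using wv eqs lev[of x] lev[of y] lev[of z] unfolding E_def by sat
  next
    case two
    obtain t s c d where ab: "a = (Some t, c)" "b = (Some s, d)" using point two by metis
    have ts: "t \<in> N" "E t" "s \<in> N" "E s" using E2 two ab by blast+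
    have "t \<noteq> s"
    proof
      assume "t = s"
      then have "c \<noteq> d" using two ab by blast
      then have "{c, d} = {0, 1}" by (cases c; cases d) auto
      then have "(Some t, 0) \<in> supp w" "(Some t, 1) \<in> supp w" using two ab \<open>t = s\<close> by (auto simp: doubleton_eq_iff)
      then show False using one_point(1)[OF w ts(1) no_inf(1)] by (simp add: supp_def)
    qed
    then have "E x \<and> E y \<or> E x \<and> E z \<or> E y \<and> E z" using ts xyz by blast
    then show False using wv eqs unfolding E_def by sat
  qed
qed

text \<open>This isolates what the gluing uses of affine geometry. \<open>ex_line\<close> includes x
  = y, so up to two affine points always lie on a line. \<open>centre\<close> takes a set, since a
  support is unordered. \<open>centre_off\<close> keeps centroids apart from the colours used on the
  line through x and y.\<close>

locale linear_space =
  fixes V :: "'v set" and lines :: "'v set set" and centre :: "'v set \<Rightarrow> 'v"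
  assumes line_subset: "L \<in> lines \<Longrightarrow> L \<subseteq> V"
    and ex_line: "x \<in> V \<Longrightarrow> y \<in> V \<Longrightarrow> \<exists>L\<in>lines. x \<in> L \<and> y \<in> L"
    and line_unique: "L \<in> lines \<Longrightarrow> L' \<in> lines \<Longrightarrow> x \<noteq> y \<Longrightarrow> {x, y} \<subseteq> L \<inter> L' \<Longrightarrow> L = L'"
    and centre_in: "x \<in> V \<Longrightarrow> y \<in> V \<Longrightarrow> z \<in> V \<Longrightarrow> card {x, y, z} = 3 \<Longrightarrow> centre {x, y, z} \<in> V"
    and centre_off: "L \<in> lines \<Longrightarrow> {x, y} \<subseteq> L \<Longrightarrow> z \<in> V \<Longrightarrow> card {x, y, z} = 3 \<Longrightarrow>
      centre {x, y, z} \<in> L \<Longrightarrow> z \<in> L"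
    and centre_inj: "x \<in> V \<Longrightarrow> y \<in> V \<Longrightarrow> z \<in> V \<Longrightarrow> z' \<in> V \<Longrightarrow> card {x, y, z} = 3 \<Longrightarrow>
      card {x, y, z'} = 3 \<Longrightarrow> centre {x, y, z} = centre {x, y, z'} \<Longrightarrow> z = z'"
begin

section \<open>Gluing the line systems with the centroid colouring\<close>

definition collinear :: "('v option \<times> bit) set \<Rightarrow> bool" where
  "collinear T \<longleftrightarrow> (\<exists>L\<in>lines. T \<subseteq> line_points L)"

text \<open>A shadow of at most two points lies on a line. Hence triples that meet infinity or
  contain two points over the same affine point are collinear, and the others project
  injectively.\<close>

lemma non_collinear_triple:
  assumes T: "T \<subseteq> line_points V" "card T = 3" "\<not> collinear T"
  shows "(None, b) \<notin> T" "card (shadow T) = 3" "shadow T \<subseteq> V"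
    and "a \<in> T \<Longrightarrow> a' \<in> T \<Longrightarrow> a \<noteq> a' \<Longrightarrow>
      \<exists>x y z. fst a = Some x \<and> fst a' = Some y \<and> shadow T = {x, y, z} \<and> {x, y, z} \<subseteq> V"
proof -
  have fin: "finite T" using T(2) card_ge_0_finite by force
  show V: "shadow T \<subseteq> V" using T(1) by (auto simp: shadow_def line_points_def)
  have sub: "T \<subseteq> line_points L" if "shadow T \<subseteq> L" for L
    by (rule subset_line_points[OF T(1) that])
  have shadow: "shadow T = (\<lambda>a. the (fst a)) ` {a \<in> T. fst a \<noteq> None}"
    by (force simp: shadow_def)
  have fino: "finite (shadow T)" unfolding shadow using fin by simp
  have not_le2: "\<not> (\<exists>x y. {x, y} \<subseteq> V \<and> shadow T \<subseteq> {x, y})"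
  proof
    assume "\<exists>x y. {x, y} \<subseteq> V \<and> shadow T \<subseteq> {x, y}"
    then obtain x y where "x \<in> V" "y \<in> V" "shadow T \<subseteq> {x, y}" by auto
    then obtain L where "L \<in> lines" "shadow T \<subseteq> L" using ex_line[of x y] by blast
    then show False using T(3) sub unfolding collinear_def by blast
  qed
  have V0: "V \<noteq> {}"
  proof
    assume "V = {}"
    then have "T \<subseteq> {(None, 0), (None, 1)}" using T(1) by (auto simp: line_points_def UNIV_bit)
    then have "card T \<le> card {(None :: 'v option, 0 :: bit), (None, 1)}" by (intro card_mono) auto
    then show False using T(2) by simp
  qed
  have ge3: "card (shadow T) \<ge> 3"
  proof (rule ccontr)
    assume "\<not> 3 \<le> card (shadow T)"
    then have "card (shadow T) = 0 \<or> card (shadow T) = 1 \<or> card (shadow T) = 2" by linarith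
    then show False
    proof (elim disjE)
      assume "card (shadow T) = 0"
      then have "shadow T = {}" using fino by simp
      then show False using not_le2 V0 by auto
    next
      assume "card (shadow T) = 1"
      then obtain x where "shadow T = {x}" by (auto simp: card_1_singleton_iff)
      then show False using not_le2 V by blast
    next
      assume "card (shadow T) = 2"
      then obtain x y where "shadow T = {x, y}" by (auto simp: card_2_iff)
      then show False using not_le2 V by blast
    qed
  qed
  have le: "card (shadow T) \<le> card {a \<in> T. fst a \<noteq> None}" unfolding shadow using fin by (intro card_image_le) simp
  have "card {a \<in> T. fst a \<noteq> None} \<le> card T" using fin by (intro card_mono) auto
  then have c3: "card {a \<in> T. fst a \<noteq> None} = 3" "card (shadow T) = 3" using le ge3 T(2) by linarith+
  show "card (shadow T) = 3" by (rule c3(2))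
  have all: "{a \<in> T. fst a \<noteq> None} = T" using card_subset_eq[OF fin, of "{a \<in> T. fst a \<noteq> None}"] c3 T(2) by auto
  then show "(None, b) \<notin> T" by force
  have inj: "inj_on (\<lambda>a. the (fst a)) T"
    using shadow fin c3(2) T(2) unfolding all by (intro eq_card_imp_inj_on) auto
  assume a: "a \<in> T" "a' \<in> T" "a \<noteq> a'"
  then have "fst a \<noteq> None" "fst a' \<noteq> None" using all by blast+
  then obtain x y where xy: "fst a = Some x" "fst a' = Some y" by blast
  then have "x \<noteq> y" using inj_onD[OF inj _ a(1,2)] a(3) by auto
  moreover have "a = (Some x, snd a)" "a' = (Some y, snd a')" using xy by (simp_all add: prod_eq_iff)
  then have "(Some x, snd a) \<in> T" "(Some y, snd a') \<in> T" using a(1,2) by simp_all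
  then have mem: "x \<in> shadow T" "y \<in> shadow T" unfolding shadow_def by blast+
  ultimately have "card (shadow T - {x, y}) = 1" using c3(2) by (simp add: card_Diff_subset)
  then obtain z where "shadow T - {x, y} = {z}" by (auto simp: card_1_singleton_iff)
  then have "shadow T = {x, y, z}" using mem by blast
  then show "\<exists>x y z. fst a = Some x \<and> fst a' = Some y \<and> shadow T = {x, y, z} \<and> {x, y, z} \<subseteq> V"
    using xy V by blast
qed

theorem ex_proper_colouring:
  assumes gadget: "\<And>L. L \<in> lines \<Longrightarrow> \<exists>blk cls. resolved_blocks (line_points L) blk cls \<and>
    (\<forall>T. T \<subseteq> line_points L \<and> card T = 3 \<longrightarrow> cls T \<in> L) \<and>
    (\<forall>x\<in>L. \<forall>T. T \<subseteq> fibre x \<and> card T = 3 \<longrightarrow> blk T = fibre x \<and> cls T = x)"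
  shows "\<exists>f. proper_on (line_points V) f \<and> f ` signed_triples (line_points V) \<subseteq> V \<times> (UNIV :: (bool \<times> bool) set)"
proof -
  obtain blk cls where res: "\<And>L. L \<in> lines \<Longrightarrow> resolved_blocks (line_points L) (blk L) (cls L)"
    and cls: "\<And>L T. L \<in> lines \<Longrightarrow> T \<subseteq> line_points L \<Longrightarrow> card T = 3 \<Longrightarrow> cls L T \<in> L"
    and fib: "\<And>L x T. L \<in> lines \<Longrightarrow> x \<in> L \<Longrightarrow> T \<subseteq> fibre x \<Longrightarrow> card T = 3 \<Longrightarrow> blk L T = fibre x \<and> cls L T = x"
  proof -
    let ?P = "\<lambda>L blk cls. resolved_blocks (line_points L) blk cls \<and>
      (\<forall>T. T \<subseteq> line_points L \<and> card T = 3 \<longrightarrow> cls T \<in> L) \<and>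
      (\<forall>x\<in>L. \<forall>T. T \<subseteq> fibre x \<and> card T = 3 \<longrightarrow> blk T = fibre x \<and> cls T = x)"
    have "\<forall>L\<in>lines. \<exists>p. ?P L (fst p) (snd p)" using gadget by simp
    then obtain p where "\<forall>L\<in>lines. ?P L (fst (p L)) (snd (p L))" by (rule bchoice[THEN exE])
    then show ?thesis by (intro that[of "\<lambda>L. fst (p L)" "\<lambda>L. snd (p L)"]) simp_all
  qed
  \<comment> \<open>A triple inside the fibre of x lies on every line through x, so a line must be
    chosen; by \<open>fib\<close> each choice gives the colour x.\<close>
  define line_of where "line_of T = (SOME L. L \<in> lines \<and> T \<subseteq> line_points L)" for T
  have line_of: "line_of T \<in> lines" "T \<subseteq> line_points (line_of T)" if "collinear T" for T
    using someI_ex[of "\<lambda>L. L \<in> lines \<and> T \<subseteq> line_points L"] that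
    unfolding line_of_def collinear_def by blast+
  define f where "f w = (let T = supp w in
     if collinear T then (cls (line_of T) T, block_colour (blk (line_of T) T) w)
     else (centre (shadow T), cube_colour w))" for w
  have "proper_on (line_points V) f"
    unfolding proper_on_def
  proof (intro ballI impI notI)
    fix w v assume wv: "w \<in> signed_triples (line_points V)" "v \<in> signed_triples (line_points V)"
      and cl: "clash w v" and eq: "f w = f v"
    define T where "T = supp w" define T' where "T' = supp v"
    have T: "T \<subseteq> line_points V" "card T = 3" and T': "T' \<subseteq> line_points V" "card T' = 3"
      using wv by (auto simp: signed_triples_def T_def T'_def)
    obtain a b where ab: "a \<noteq> b" "{a, b} \<subseteq> T \<inter> T'"
      using clash_common_pair[OF cl] T by (auto simp: T_def T'_def)
    \<comment> \<open>The colour of a collinear triple lies on its line. If a centroid over x, y, z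
      lies on the line through x and y, so does z.\<close>
    have mixed: False
      if S: "S \<subseteq> line_points V" "card S = 3" "collinear S" and S': "S' \<subseteq> line_points V" "card S' = 3" "\<not> collinear S'"
        and ab: "{a, b} \<subseteq> S \<inter> S'" and c: "cls (line_of S) S = centre (shadow S')" for S S'
    proof -
      have "a \<in> S'" "b \<in> S'" using ab by auto
      from non_collinear_triple(4)[OF S' this \<open>a \<noteq> b\<close>] obtain x y z
        where xyz: "fst a = Some x" "fst b = Some y" "shadow S' = {x, y, z}" "{x, y, z} \<subseteq> V" by blast
      have "a \<in> line_points (line_of S)" "b \<in> line_points (line_of S)" using line_of(2)[OF S(3)] ab by blast+
      then have xy: "{x, y} \<subseteq> line_of S" using xyz(1,2) by (cases a; cases b) (auto simp: line_points_def)
      have "centre {x, y, z} \<in> line_of S" using cls[OF line_of[OF S(3)] S(2)] c xyz(3) by simp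
      then have "z \<in> line_of S"
        using centre_off[OF line_of(1)[OF S(3)] xy, of z] xyz non_collinear_triple(2)[OF S'] by simp
      then have "shadow S' \<subseteq> line_of S" using xy xyz(3) by simp
      then have "S' \<subseteq> line_points (line_of S)" by (rule subset_line_points[OF S'(1)])
      then show False using S'(3) line_of(1)[OF S(3)] unfolding collinear_def by blast
    qed
    show False
    proof (cases "collinear T"; cases "collinear T'")
      assume ct: "collinear T" "collinear T'"
      define L where "L = line_of T" define L' where "L' = line_of T'"
      note L = line_of[OF ct(1), folded L_def] and L' = line_of[OF ct(2), folded L'_def]
      have eq': "cls L T = cls L' T'" "block_colour (blk L T) w = block_colour (blk L' T') v"
        using eq ct unfolding f_def by (simp_all add: Let_def T_def T'_def L_def L'_def)
      define c where "c = cls L T"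
      have c: "c \<in> L" "c \<in> L'" using cls[OF L T(2)] cls[OF L' T'(2)] eq' by (simp_all add: c_def)
      have "blk L T = blk L' T'"
      proof (cases "L = L'")
        case True
        then show ?thesis using resolved_blocks_eq[OF res[OF L(1)] L(2) T(2) _ T'(2) ab] L'(2) eq'(1) by simp
      next
        case False
        \<comment> \<open>The colour c belongs to both lines and is therefore their only common
          point, so a and b lie over c or infinity.\<close>
        have "e \<in> fibre c" if "e \<in> {a, b}" for e
        proof -
          have "e \<in> line_points L" "e \<in> line_points L'" using that ab L(2) L'(2) by blast+
          then show ?thesis using line_unique[OF L(1) L'(1)] c False
            by (cases e) (auto simp: line_points_def fibre_def)
        qed
        then have abf: "{a, b} \<subseteq> fibre c" by blast
        have "card (fibre c - {a, b}) = 2" using abf ab(1) card_fibre(1)[of c] by (simp add: card_Diff_subset)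
        \<comment> \<open>Blocks are named by triples: e completes a, b to a triple \<open>R\<close>
          whose block is the fibre. In either system the block of colour c through a and b is
          unique, hence equal to that fibre.\<close>
        then obtain e where e: "e \<in> fibre c" "e \<notin> {a, b}" by (metis DiffE card.empty equals0I zero_neq_numeral)
        define R where "R = {a, b, e}"
        have R: "R \<subseteq> fibre c" "card R = 3" "{a, b} \<subseteq> R" using e abf ab(1) by (auto simp: R_def)
        have key: "blk M S = fibre c" if M: "M \<in> lines" "c \<in> M" and S: "S \<subseteq> line_points M" "card S = 3" "{a, b} \<subseteq> S" "cls M S = c" for M S
        proof -
          have "R \<subseteq> line_points M" using R(1) fibre_subset[OF M(2)] by blast
          then have "blk M S = blk M R"
            using resolved_blocks_eq[OF res[OF M(1)] S(1,2) _ R(2) ab(1)] S R fib[OF M R(1,2)] by simp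
          then show ?thesis using fib[OF M R(1,2)] by simp
        qed
        show ?thesis
          using key[OF L(1) c(1) L(2) T(2)] key[OF L'(1) c(2) L'(2) T'(2)] ab(2) eq'(1) by (simp add: c_def)
      qed
      moreover note resolved_blocks_block[OF res[OF L(1)] L(2) T(2)] resolved_blocks_block[OF res[OF L'(1)] L'(2) T'(2)]
      ultimately show False
        using block_colour_separates[OF cl wv, of "blk L T"] eq'(2) by (simp add: T_def T'_def)
    next
      assume "collinear T" "\<not> collinear T'"
      then show False using mixed[of T T'] T T' ab(2) eq by (simp add: f_def Let_def T_def T'_def)
    next
      assume "\<not> collinear T" "collinear T'"
      then show False using mixed[of T' T] T T' ab(2) eq by (simp add: f_def Let_def T_def T'_def Int_commute)
    next
      assume nc: "\<not> collinear T" "\<not> collinear T'"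
      have ce: "centre (shadow T) = centre (shadow T')" "cube_colour w = cube_colour v"
        using eq nc by (simp_all add: f_def Let_def T_def T'_def)
      note nT = non_collinear_triple[OF T nc(1)] and nT' = non_collinear_triple[OF T' nc(2)]
      obtain x y z where xyz: "fst a = Some x" "fst b = Some y" "shadow T = {x, y, z}" "{x, y, z} \<subseteq> V"
        using nT(4)[of a b] ab by auto
      obtain z' where z': "shadow T' = {x, y, z'}" "z' \<in> V"
        using nT'(4)[of a b] ab xyz(1,2) by auto
      \<comment> \<open>Equal centroids and a common pair force equal shadows, which leaves the
        Latin cube to separate the words.\<close>
      have "z = z'" using centre_inj[of x y z z'] xyz z' nT(2) nT'(2) ce(1) by simp
      then have "shadow T' = shadow T" using xyz z' by simp
      then show False
        using cube_colour_separates[OF wv(1) _ wv(2) _ nT(2)] nT(1) nT'(1) cl ce(2) by (simp add: T_def T'_def)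
    qed
  qed
  moreover have "f w \<in> V \<times> UNIV" if "w \<in> signed_triples (line_points V)" for w
  proof -
    have T: "supp w \<subseteq> line_points V" "card (supp w) = 3" using that by (auto simp: signed_triples_def)
    show ?thesis
    proof (cases "collinear (supp w)")
      case True
      then show ?thesis using cls[OF line_of[OF True] T(2)] line_subset[OF line_of(1)[OF True]]
        by (auto simp: f_def Let_def)
    next
      case False
      note n = non_collinear_triple[OF T False]
      obtain x y z where "shadow (supp w) = {x, y, z}" using n(2) by (auto simp: card_3_iff)
      then have "centre (shadow (supp w)) \<in> V" using n(2,3) centre_in[of x y z] by simp
      then show ?thesis using False by (simp add: f_def Let_def)
    qed
  qed
  ultimately show ?thesis by blast
qed

end

section \<open>Affine spaces\<close>

text \<open>Padding by zeros keeps the dimension m a number and the type of points fixed.\<close>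

definition affine_space :: "nat \<Rightarrow> (nat \<Rightarrow> 'r::comm_ring_1) set" where
  "affine_space m = {x. \<forall>i\<ge>m. x i = 0}"

definition affine_line :: "(nat \<Rightarrow> 'r::comm_ring_1) \<Rightarrow> (nat \<Rightarrow> 'r) \<Rightarrow> (nat \<Rightarrow> 'r) set" where
  "affine_line x d = range (\<lambda>t i. x i + t * d i)"

definition affine_lines :: "nat \<Rightarrow> (nat \<Rightarrow> 'r::comm_ring_1) set set" where
  "affine_lines m = {affine_line x d |x d. x \<in> affine_space m \<and> d \<in> affine_space m \<and> d \<noteq> (\<lambda>_. 0)}"

lemma card_affine_space:
  "finite (affine_space m :: (nat \<Rightarrow> 'r::{comm_ring_1,finite}) set)"
  "card (affine_space m :: (nat \<Rightarrow> 'r) set) = CARD('r) ^ m"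
proof -
  let ?g = "\<lambda>x::nat \<Rightarrow> 'r. restrict x {..<m}"
  have "bij_betw ?g (affine_space m) ({..<m} \<rightarrow>\<^sub>E UNIV)"
  proof (rule bij_betw_byWitness[where f' = "\<lambda>x i. if i < m then x i else 0"])
    show "\<forall>x\<in>affine_space m. (\<lambda>i. if i < m then ?g x i else 0) = x"
      by (auto simp: affine_space_def fun_eq_iff)
    show "\<forall>x\<in>{..<m} \<rightarrow>\<^sub>E UNIV. ?g (\<lambda>i. if i < m then x i else 0) = x"
      by (auto simp: fun_eq_iff PiE_def extensional_def)
    show "?g ` affine_space m \<subseteq> {..<m} \<rightarrow>\<^sub>E UNIV"
      by (simp add: image_subset_iff restrict_PiE_iff)
    show "(\<lambda>x i. if i < m then x i else 0) ` ({..<m} \<rightarrow>\<^sub>E UNIV) \<subseteq> affine_space m"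
      by (simp add: image_subset_iff affine_space_def)
  qed
  note bij = bij_betw_finite[OF this] bij_betw_same_card[OF this]
  show "finite (affine_space m :: (nat \<Rightarrow> 'r) set)" unfolding bij(1) by (simp add: finite_PiE)
  show "card (affine_space m :: (nat \<Rightarrow> 'r) set) = CARD('r) ^ m" unfolding bij(2) by (simp add: card_PiE)
qed

text \<open>Inverses appear as a hypothesis because the scalars will be residues modulo p, whose
  type is a commutative ring for any modulus; primality enters in
  \<open>prime_bit1_inverse\<close>.\<close>

lemma affine_line_through:
  assumes inv: "\<And>s::'r::comm_ring_1. s \<noteq> 0 \<Longrightarrow> \<exists>t. s * t = 1"
    and L: "L \<in> affine_lines m" and p: "p \<in> L" and q: "q \<in> L" and "p \<noteq> (q :: nat \<Rightarrow> 'r)"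
  shows "L = affine_line p (\<lambda>i. q i - p i)"
proof -
  obtain x d where Lx: "L = affine_line x d" using L by (auto simp: affine_lines_def)
  obtain s t where st: "p = (\<lambda>i. x i + s * d i)" "q = (\<lambda>i. x i + t * d i)"
    using p q unfolding Lx by (auto simp: affine_line_def)
  have "t - s \<noteq> 0" using st \<open>p \<noteq> q\<close> by auto
  then obtain u where u: "(t - s) * u = 1" using inv by blast
  show ?thesis
    unfolding Lx
  proof
    show "affine_line p (\<lambda>i. q i - p i) \<subseteq> affine_line x d"
    proof
      fix y assume "y \<in> affine_line p (\<lambda>i. q i - p i)"
      then obtain r where "y = (\<lambda>i. p i + r * (q i - p i))" by (auto simp: affine_line_def)
      then have "y = (\<lambda>i. x i + (s + r * (t - s)) * d i)" by (simp add: st algebra_simps)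
      then show "y \<in> affine_line x d" unfolding affine_line_def by blast
    qed
  next
    show "affine_line x d \<subseteq> affine_line p (\<lambda>i. q i - p i)"
    proof
      fix y assume "y \<in> affine_line x d"
      then obtain r where y: "y = (\<lambda>i. x i + r * d i)" by (auto simp: affine_line_def)
      have "y i = p i + ((r - s) * u) * (q i - p i)" for i
      proof -
        have "p i + ((r - s) * u) * (q i - p i) = x i + s * d i + (r - s) * ((t - s) * u) * d i"
          unfolding st by (simp add: algebra_simps)
        then show ?thesis unfolding u y by (simp add: algebra_simps)
      qed
      then have "y = (\<lambda>i. p i + ((r - s) * u) * (q i - p i))" by blast
      then show "y \<in> affine_line p (\<lambda>i. q i - p i)" unfolding affine_line_def by blast
    qed
  qed
qed

lemma card_affine_line:
  assumes inv: "\<And>s::'r::{comm_ring_1,finite}. s \<noteq> 0 \<Longrightarrow> \<exists>t. s * t = 1" and "L \<in> affine_lines m"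
  shows "finite L" "card (L :: (nat \<Rightarrow> 'r) set) = CARD('r)"
proof -
  obtain x d where L: "L = affine_line x d" and "d \<noteq> (\<lambda>_. 0)" using assms(2) by (auto simp: affine_lines_def)
  then obtain i where i: "d i \<noteq> 0" by blast
  have "inj (\<lambda>t i. x i + t * d i)"
  proof (rule injI)
    fix s t assume "(\<lambda>i. x i + s * d i) = (\<lambda>i. x i + t * d i)"
    then have "s * d i = t * d i" by (metis add_left_cancel)
    moreover obtain u where "d i * u = 1" using inv[OF i] by blast
    ultimately show "s = t" by (metis mult.assoc mult.right_neutral)
  qed
  then show "card L = CARD('r)" unfolding L affine_line_def by (rule card_image)
  show "finite L" unfolding L affine_line_def by simp
qed

text \<open>With c the centroid, z = 3c - x - y. The coefficients add up to 1, so z lies on any line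
  containing c, x and y; and c, x, y determine z.\<close>

lemma linear_space_affine:
  fixes third :: "'r::{comm_ring_1,finite}"
  assumes inv: "\<And>s::'r. s \<noteq> 0 \<Longrightarrow> \<exists>t. s * t = 1" and third: "3 * third = 1" and m: "m \<ge> 1"
  shows "linear_space (affine_space m) (affine_lines m) (\<lambda>N i. third * (\<Sum>x\<in>N. x i))"
proof
  let ?c = "\<lambda>N i. third * (\<Sum>x\<in>N. x i)"
  have c: "?c {x, y, z} i = third * (x i + y i + z i)" if "card {x, y, z} = 3" for x y z :: "nat \<Rightarrow> 'r" and i
  proof -
    have "x \<noteq> y" "x \<noteq> z" "y \<noteq> z" using that by (auto simp: card_insert_if split: if_splits)
    then show ?thesis by (simp add: add.assoc)
  qed
  have ci: "x i + y i + z i = 3 * ?c {x, y, z} i" if "card {x, y, z} = 3" for x y z :: "nat \<Rightarrow> 'r" and i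
    unfolding c[OF that] mult.assoc[symmetric] third by simp
  show "L \<subseteq> affine_space m" if "L \<in> affine_lines m" for L :: "(nat \<Rightarrow> 'r) set"
    using that by (auto simp: affine_lines_def affine_line_def affine_space_def)
  show "\<exists>L\<in>affine_lines m. x \<in> L \<and> y \<in> L" if "x \<in> affine_space m" "y \<in> affine_space m" for x y :: "nat \<Rightarrow> 'r"
  proof -
    \<comment> \<open>If x = y, any direction will do; the first unit vector lies in the space since
      m is at least 1.\<close>
    define d where "d = (if x = y then (\<lambda>i. if i = 0 then 1 else 0) else (\<lambda>i. y i - x i))"
    have "d \<in> affine_space m" using that m by (auto simp: d_def affine_space_def)
    moreover have "d \<noteq> (\<lambda>_. 0)"
    proof (cases "x = y")
      case False
      then obtain i where "x i \<noteq> y i" by blast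
      then have "d i \<noteq> 0" using False by (simp add: d_def)
      then show ?thesis by auto
    next
      case True
      then have "d 0 \<noteq> 0" by (simp add: d_def)
      then show ?thesis by auto
    qed
    moreover have "x = (\<lambda>i. x i + 0 * d i)" by simp
    then have "x \<in> affine_line x d" unfolding affine_line_def by blast
    moreover have "y = (\<lambda>i. x i + (if x = y then 0 else 1) * d i)" by (auto simp: d_def)
    then have "y \<in> affine_line x d" unfolding affine_line_def by blast
    ultimately show ?thesis using that(1) unfolding affine_lines_def by blast
  qed
  show "L = L'" if "L \<in> affine_lines m" "L' \<in> affine_lines m" "x \<noteq> y" "{x, y} \<subseteq> L \<inter> L'"
    for L L' :: "(nat \<Rightarrow> 'r) set" and x y
    using affine_line_through[OF inv that(1), of x y] affine_line_through[OF inv that(2), of x y] that(3,4) by simp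
  show "?c {x, y, z} \<in> affine_space m"
    if "x \<in> affine_space m" "y \<in> affine_space m" "z \<in> affine_space m" "card {x, y, z} = 3" for x y z :: "nat \<Rightarrow> 'r"
    using that(1-3) unfolding affine_space_def mem_Collect_eq c[OF that(4)] by simp
  show "z \<in> L" if L: "L \<in> affine_lines m" "{x, y} \<subseteq> L" and card: "card {x, y, z} = 3" and cL: "?c {x, y, z} \<in> L"
    for L and x y z :: "nat \<Rightarrow> 'r"
  proof -
    have "x \<noteq> y" using card by (auto simp: card_insert_if split: if_splits)
    then have Lxy: "L = affine_line x (\<lambda>i. y i - x i)"
      using affine_line_through[OF inv L(1), of x y] L(2) by simp
    then obtain t where t: "?c {x, y, z} = (\<lambda>i. x i + t * (y i - x i))" using cL by (auto simp: affine_line_def)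
    \<comment> \<open>Substitute c = x + t(y - x) into z = 3c - x - y.\<close>
    have "z i = x i + (3 * t - 1) * (y i - x i)" for i
    proof -
      have "x i + y i + z i = 3 * (x i + t * (y i - x i))" using ci[OF card, of i] fun_cong[OF t, of i] by simp
      then have "z i = 3 * (x i + t * (y i - x i)) - x i - y i" by (simp add: algebra_simps)
      then show ?thesis by (simp add: algebra_simps)
    qed
    then have "z = (\<lambda>i. x i + (3 * t - 1) * (y i - x i))" by blast
    then show ?thesis unfolding Lxy affine_line_def by blast
  qed
  show "z = z'" if "card {x, y, z} = 3" "card {x, y, z'} = 3" "?c {x, y, z} = ?c {x, y, z'}" for x y z z' :: "nat \<Rightarrow> 'r"
  proof
    fix i
    have "x i + y i + z i = x i + y i + z' i"
      unfolding ci[OF that(1)] ci[OF that(2)] using fun_cong[OF that(3), of i] by simp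
    then show "z i = z' i" by simp
  qed
qed

lemma prime_bit1_inverse:
  assumes "prime CARD('a::finite bit1)" and "s \<noteq> (0 :: 'a bit1)"
  shows "\<exists>t. s * t = 1"
proof -
  let ?p = "int CARD('a bit1)"
  obtain z where z: "s = of_int z" "0 \<le> z" "z < ?p" by (cases s) auto
  have "z \<noteq> 0" using z assms(2) by auto
  then have "\<not> ?p dvd z" using z zdvd_not_zless by auto
  moreover have "prime ?p" using assms(1) by (simp only: prime_nat_int_transfer)
  ultimately have "coprime ?p z" by (intro prime_imp_coprime)
  then obtain u v where uv: "u * ?p + v * z = 1" using bezout_int[of ?p z] by (auto simp: coprime_iff_gcd_eq_1)
  have "of_nat CARD('a bit1) = (0 :: 'a bit1)" using of_nat_CHAR[where 'a = "'a bit1"] by simp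
  then have "(of_int ?p :: 'a bit1) = 0" by (simp only: of_int_of_nat_eq)
  then have "of_int z * of_int v = (1 :: 'a bit1)"
    using arg_cong[OF uv, of "of_int :: int \<Rightarrow> 'a bit1"] by (simp only: of_int_add of_int_mult) (simp add: mult.commute)
  then show ?thesis using z(1) by blast
qed

section \<open>The two families of parameters\<close>

theorem TOC_of_affine_space:
  assumes inv: "\<And>s::'r::{comm_ring_1,finite}. s \<noteq> 0 \<Longrightarrow> \<exists>t. s * t = 1" and three: "(3::'r) \<noteq> 0"
    and k: "odd k" "CARD('r) + 1 = 2 ^ k" and mod3: "CARD('r) mod 3 = 1" and m: "m \<ge> 1"
  shows "\<exists>P. is_TOC 3 (2 * CARD('r) ^ m + 2) 3 3 P"
proof -
  let ?V = "affine_space m :: (nat \<Rightarrow> 'r) set"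
  obtain third :: 'r where third: "3 * third = 1" using inv[OF three] by blast
  interpret linear_space ?V "affine_lines m" "\<lambda>N i. third * (\<Sum>x\<in>N. x i)"
    by (rule linear_space_affine[OF inv third m])
  have "\<exists>blk cls. resolved_blocks (line_points L) blk cls \<and>
    (\<forall>T. T \<subseteq> line_points L \<and> card T = 3 \<longrightarrow> cls T \<in> L) \<and>
    (\<forall>x\<in>L. \<forall>T. T \<subseteq> fibre x \<and> card T = 3 \<longrightarrow> blk T = fibre x \<and> cls T = x)"
    if "L \<in> affine_lines m" for L :: "(nat \<Rightarrow> 'r) set"
  proof (rule odd_gf2.ex_line_blocks[OF odd_gf2_exists(1)[OF k(1)]])
    show "finite L" by (rule card_affine_line(1)[OF inv that])
    show "card L + 1 = card {x :: bit alg_closure. x ^ (2 ^ k) = x}"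
      using odd_gf2_exists(2)[OF k(1)] card_affine_line(2)[OF inv that] k(2) by simp
  qed
  from ex_proper_colouring[OF this] obtain f where f: "proper_on (line_points ?V) f"
    "f ` signed_triples (line_points ?V) \<subseteq> ?V \<times> (UNIV :: (bool \<times> bool) set)" by blast
  have cV: "finite ?V" "card ?V = CARD('r) ^ m" by (rule card_affine_space)+
  show ?thesis
  proof (rule TOC_of_proper_colouring[OF _ _ _ _ _ _ f(2) f(1)])
    show "finite (line_points ?V)" using cV(1) by (simp add: line_points_def UNIV_bit)
    show "card (line_points ?V) = 2 * CARD('r) ^ m + 2"
      using cV by (simp add: line_points_def card_cartesian_product UNIV_bit card_insert_if card_image image_iff)
    have "CARD('r) ^ m mod 3 = 1" using power_mod[of "CARD('r)" 3 m] mod3 by simp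
    then show "(2 * CARD('r) ^ m + 2) mod 3 = 1" by presburger
    show "4 \<le> 2 * CARD('r) ^ m + 2" using zero_less_card_finite[where 'a = 'r] by (simp add: Suc_leI)
    show "finite (?V \<times> (UNIV :: (bool \<times> bool) set))" using cV(1) by simp
    \<comment> \<open>There are 4p^m colours, and n - 2 = 2p^m.\<close>
    show "card (?V \<times> (UNIV :: (bool \<times> bool) set)) \<le> 2 * (2 * CARD('r) ^ m + 2 - 2)"
      using cV by (simp add: card_cartesian_product)
  qed
qed

text \<open>The planes over GF(2^k) with k = 2m - 1 suffice on their own: k is odd, there are 2 *
  2^k = 4^m points, and 4(2^k - 1) = 2(4^m - 2) colours.\<close>

theorem TOC_power_of_four:
  assumes "m \<ge> 1"
  shows "\<exists>P. is_TOC 3 (4 ^ m) 3 3 P"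
proof -
  define k where "k = 2 * m - 1"
  have k: "odd k" using assms by (simp add: k_def)
  define F where "F = {x :: bit alg_closure. x ^ (2 ^ k) = x}"
  interpret odd_gf2 F unfolding F_def by (rule odd_gf2_exists(1)[OF k])
  have cF: "card F = 2 ^ k" unfolding F_def by (rule odd_gf2_exists(2)[OF k])
  have "2 * 2 ^ k = (2::nat) ^ (2 * m)" using assms by (simp add: k_def flip: power_Suc)
  then have four: "2 * 2 ^ k = (4::nat) ^ m" by (simp add: power_mult)
  let ?f = "\<lambda>w. (triple_colour (supp w), block_colour (plane (supp w)) w)"
  let ?C = "(F - {0}) \<times> (UNIV :: (bool \<times> bool) set)"
  show ?thesis
  proof (rule TOC_of_proper_colouring[where pts = pts and f = ?f and C = ?C])
    show "finite pts" using finite_F by (simp add: UNIV_bit)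
    show "card pts = 4 ^ m" using cF four by (simp add: card_cartesian_product UNIV_bit)
    show "4 \<le> (4::nat) ^ m" using assms by (cases m) auto
    show "(4::nat) ^ m mod 3 = 1" by (induction m) (simp_all add: mod_mult_right_eq[symmetric, of 4])
    show "finite ?C" using finite_F by simp
    show "card ?C \<le> 2 * (4 ^ m - 2)" using cF four finite_F zero_F by (simp add: card_cartesian_product)
    show "?f ` signed_triples pts \<subseteq> ?C"
      using triple_colour_cube(2) by (fastforce simp: signed_triples_def)
    show "proper_on pts ?f" by (rule proper_on_of_resolved_blocks[OF resolved_blocks_plane])
  qed
qed

theorem theorem4p4:
  fixes n :: nat
  assumes "n \<in> Kset"
  shows "\<exists>P. is_TOC 3 n 3 3 P"
proof -
  have *: "\<exists>P. is_TOC 3 (2 * 7 ^ m + 2) 3 3 P" "\<exists>P. is_TOC 3 (2 * 31 ^ m + 2) 3 3 P"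
    "\<exists>P. is_TOC 3 (2 * 127 ^ m + 2) 3 3 P" if "m \<ge> 1" for m
    \<comment> \<open>The exponents 3, 5, 7 are the odd k with 2^k = 8, 32, 128, that is p +
      1.\<close>
    using TOC_of_affine_space[where 'r = 7, OF prime_bit1_inverse _ _ _ _ that, of 3]
      TOC_of_affine_space[where 'r = 31, OF prime_bit1_inverse _ _ _ _ that, of 5]
      TOC_of_affine_space[where 'r = 127, OF prime_bit1_inverse _ _ _ _ that, of 7]
    by simp_all
  from assms consider m where "m \<ge> 1" "n = 4 ^ m"
    | p m where "p \<in> {7, 31, 127}" "m \<ge> 1" "n = 2 * p ^ m + 2"
    unfolding Kset_def by blast
  then show ?thesis
  proof cases
    case 1
    then show ?thesis using TOC_power_of_four by blast
  next
    case 2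
    then show ?thesis using * by blast
  qed
qed

end
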